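(* Consider the mixed random environment model with drift parameter $\delta \in (-1,1)$ described in the context. Suppose that the distribution of $\zeta_0$ is symmetric about $0$, i.e. $\mathbb{P}[\zeta_0 \le -x] = \mathbb{P}[\zeta_0 \ge x]$ for all $x \ge 0$, and that $\mathbb{E}[\zeta_0^2] \in (0,\infty)$. Suppose that $\phi(n) = n^{-\beta}$ for all $n \ge 1$ (with $\phi(0) \in [0,1]$ arbitrary), where $\beta \in (0,1)$. (i) Suppose that $\beta < \frac{1}{2}$. If $\delta < 0$, then $X$ is recurrent for $\mathbb{P}$-a.e. $\omega$. If $\delta > 0$, then $X$ is transient for $\mathbb{P}$-a.e. $\omega$. (ii) Suppose that $\beta > \frac{1}{2}$. Then (for any $\delta \in (-1,1)$) $X$ is recurrent for $\mathbb{P}$-a.e. $\omega$.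
   Context: Random environment. Let $\mathbb{Z}_+ = \{0,1,2,\ldots\}$. Fix $\delta \in (-1,1)$ and a function $\phi : \mathbb{Z}_+ \to [0,1]$. On a probability space $(\Omega,\mathcal{F},\mathbb{P})$ (with expectation $\mathbb{E}$), let $\chi_0,\chi_1,\ldots$ be independent $\{0,1\}$-valued random variables with $\mathbb{P}[\chi_n = 1] = \phi(n)$, and let $\xi_0,\xi_1,\ldots$ be i.i.d. $(0,1)$-valued random variables, independent of the $\chi_i$. Set $p_n = \frac{1-\delta}{2}\chi_n + \xi_n(1-\chi_n)$, $q_n = 1-p_n$, and $\zeta_n = \log\left(\frac{\xi_n}{1-\xi_n}\right)$. The environment is $\omega = (p_0,p_1,p_2,\ldots)$. Random walk. For fixed $\omega$, under the quenched law $P_\omega$, $X = (X_t)_{t \in \mathbb{Z}_+}$ is the Markov chain on $\mathbb{Z}_+$ with $X_0 = 0$ and, for $n \ge 1$, $P_\omega[X_{t+1} = n-1 \mid X_t = n] = p_n$ and $P_\omega[X_{t+1} = n+1 \mid X_t = n] = q_n$; and $P_\omega[X_{t+1} = 0 \mid X_t = 0] = p_0$, $P_\omega[X_{t+1} = 1 \mid X_t = 0] = q_0$. It is irreducible and aperiodic. "Recurrent" and "transient" refer to this Markov chain under $P_\omega$. *)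

theory Defs
  imports "HOL-Probability.Probability"
begin

text \<open>
  The chain with transition kernel \<open>K\<close> started at \<open>x\<close> is realised by independent moves: \<open>Y (t, y)\<close>
  has distribution \<open>K y\<close> and is the position at time \<open>t + 1\<close> if the chain is at \<open>y\<close> at time \<open>t\<close>.
  Lemmas \<open>chain_law_path\<close> and \<open>chain_law_Markov\<close> below show that \<open>chain_law K x\<close> is the law of the
  Markov chain with kernel \<open>K\<close> and initial state \<open>x\<close>.
\<close>

primrec chain_path :: "nat \<Rightarrow> (nat \<times> nat \<Rightarrow> nat) \<Rightarrow> nat \<Rightarrow> nat" where
  "chain_path x Y 0 = x"
| "chain_path x Y (Suc t) = Y (t, chain_path x Y t)"

definition moves :: "(nat \<Rightarrow> nat pmf) \<Rightarrow> (nat \<times> nat \<Rightarrow> nat) measure" where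
  "moves K = (\<Pi>\<^sub>M ty\<in>UNIV. measure_pmf (K (snd ty)))"

definition chain_law :: "(nat \<Rightarrow> nat pmf) \<Rightarrow> nat \<Rightarrow> (nat \<Rightarrow> nat) measure" where
  "chain_law K x = distr (moves K) (\<Pi>\<^sub>M t\<in>UNIV. count_space UNIV) (chain_path x)"

definition return_prob :: "(nat \<Rightarrow> nat pmf) \<Rightarrow> nat \<Rightarrow> real" where
  "return_prob K x = measure (chain_law K x) {X. \<exists>t\<ge>1. X t = x}"

text \<open>Every state is required to be recurrent, respectively transient; for irreducible chains this is
  equivalent to one state being so.\<close>

definition recurrent_chain :: "(nat \<Rightarrow> nat pmf) \<Rightarrow> bool" where
  "recurrent_chain K \<longleftrightarrow> (\<forall>x. return_prob K x = 1)"

definition transient_chain :: "(nat \<Rightarrow> nat pmf) \<Rightarrow> bool" where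
  "transient_chain K \<longleftrightarrow> (\<forall>x. return_prob K x < 1)"

lemma prob_space_moves: "prob_space (moves K)"
  unfolding moves_def by (intro prob_space_PiM measure_pmf.prob_space_axioms)

lemma space_moves [simp]: "space (moves K) = UNIV"
  by (simp add: moves_def space_PiM)

lemma measurable_move: "(\<lambda>Y. Y i) \<in> measurable (moves K) (count_space UNIV)"
proof -
  have "(\<lambda>Y. Y i) \<in> measurable (moves K) (measure_pmf (K (snd i)))"
    unfolding moves_def by (rule measurable_component_singleton) simp
  then show ?thesis by (simp cong: measurable_cong_sets)
qed

lemma measurable_chain_path_component:
  "(\<lambda>Y. chain_path x Y t) \<in> measurable (moves K) (count_space UNIV)"
proof (induction t)
  case (Suc t)
  show ?case
    unfolding chain_path.simps
    by (rule measurable_compose_countable[OF _ Suc]) (rule measurable_move)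
qed simp

lemma measurable_chain_path:
  "chain_path x \<in> measurable (moves K) (\<Pi>\<^sub>M t\<in>UNIV. count_space UNIV)"
  by (rule measurable_PiM_single') (auto simp: measurable_chain_path_component)

lemma prob_space_chain_law: "prob_space (chain_law K x)"
  unfolding chain_law_def
  by (rule prob_space.prob_space_distr[OF prob_space_moves measurable_chain_path])

lemma space_chain_law [simp]: "space (chain_law K x) = UNIV"
  by (simp add: chain_law_def space_PiM)

lemma sets_chain_law [measurable_cong]:
  "sets (chain_law K x) = sets (\<Pi>\<^sub>M t\<in>UNIV. count_space UNIV)"
  by (simp add: chain_law_def)

lemma sets_path:
  fixes t :: nat
  shows "{X. \<forall>i\<le>t. X i = a i} \<in> sets (\<Pi>\<^sub>M t\<in>UNIV. count_space (UNIV :: nat set))"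
proof -
  have "{X. \<forall>i\<le>t. X i = a i} =
      prod_emb UNIV (\<lambda>_. count_space UNIV) {..t} (\<Pi>\<^sub>E i\<in>{..t}. {a i})"
    by (auto simp: prod_emb_def space_PiM PiE_iff)
  also have "\<dots> \<in> sets (\<Pi>\<^sub>M t\<in>UNIV. count_space UNIV)"
    by (rule sets_PiM_I) auto
  finally show ?thesis .
qed

lemma chain_path_eq_iff:
  "(\<forall>i\<le>t. chain_path x Y i = a i) \<longleftrightarrow> a 0 = x \<and> (\<forall>i<t. Y (i, a i) = a (Suc i))"
proof (induction t)
  case (Suc t)
  have "(\<forall>i\<le>Suc t. chain_path x Y i = a i) \<longleftrightarrow>
        (\<forall>i\<le>t. chain_path x Y i = a i) \<and> chain_path x Y (Suc t) = a (Suc t)"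
    by (auto simp: le_Suc_eq)
  also have "\<dots> \<longleftrightarrow> (\<forall>i\<le>t. chain_path x Y i = a i) \<and> Y (t, a t) = a (Suc t)"
    by auto
  also have "\<dots> \<longleftrightarrow> a 0 = x \<and> (\<forall>i<Suc t. Y (i, a i) = a (Suc i))"
    unfolding Suc.IH by (auto simp: less_Suc_eq)
  finally show ?case .
qed auto

lemma chain_law_path:
  "measure (chain_law K x) {X. \<forall>i\<le>t. X i = a i} =
    (if a 0 = x then \<Prod>i<t. pmf (K (a i)) (a (Suc i)) else 0)"
proof -
  interpret P: product_prob_space "\<lambda>ty :: nat \<times> nat. measure_pmf (K (snd ty))" UNIV
    by unfold_locales
  have *: "measure (chain_law K x) {X. \<forall>i\<le>t. X i = a i} =
      measure (moves K) {Y. a 0 = x \<and> (\<forall>i<t. Y (i, a i) = a (Suc i))}"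
    unfolding chain_law_def
    by (subst measure_distr[OF measurable_chain_path sets_path])
       (simp add: vimage_def chain_path_eq_iff)
  show ?thesis
  proof (cases "a 0 = x")
    case True
    define J where "J = (\<lambda>i. (i, a i)) ` {..<t}"
    have inj: "inj_on (\<lambda>i. (i, a i)) {..<t}" by (auto simp: inj_on_def)
    have "{Y. \<forall>i<t. Y (i, a i) = a (Suc i)} =
        prod_emb UNIV (\<lambda>ty. measure_pmf (K (snd ty))) J (\<Pi>\<^sub>E ty\<in>J. {a (Suc (fst ty))})"
      by (auto simp: prod_emb_def J_def space_PiM PiE_iff)
    then have "measure (moves K) {Y. \<forall>i<t. Y (i, a i) = a (Suc i)} =
        (\<Prod>ty\<in>J. measure (measure_pmf (K (snd ty))) {a (Suc (fst ty))})"
      unfolding moves_def by (simp only:) (rule P.measure_PiM_emb, auto simp: J_def)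
    also have "\<dots> = (\<Prod>i<t. pmf (K (a i)) (a (Suc i)))"
      unfolding J_def by (subst prod.reindex[OF inj]) (simp add: pmf.rep_eq)
    finally show ?thesis using True * by simp
  qed (simp add: *)
qed

lemma chain_law_Markov:
  "measure (chain_law K x) {X. (\<forall>i\<le>t. X i = a i) \<and> X (Suc t) = y} =
    measure (chain_law K x) {X. \<forall>i\<le>t. X i = a i} * pmf (K (a t)) y"
proof -
  have "{X. (\<forall>i\<le>t. X i = a i) \<and> X (Suc t) = y} =
      {X. \<forall>i\<le>Suc t. X i = (a(Suc t := y)) i}"
    by (auto simp: le_Suc_eq)
  then show ?thesis
    by (simp add: chain_law_path)
qed


locale mixed_environment = prob_space M
  for M :: "'a measure" +
  fixes \<delta> :: real and \<phi> :: "nat \<Rightarrow> real" and chi \<xi> :: "nat \<Rightarrow> 'a \<Rightarrow> real"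
  assumes \<delta>_bounds: "-1 < \<delta>" "\<delta> < 1"
    and \<phi>_bounds: "\<And>n. 0 \<le> \<phi> n \<and> \<phi> n \<le> 1"
    and chi_values: "\<And>n w. w \<in> space M \<Longrightarrow> chi n w \<in> {0, 1}"
    and chi_prob: "\<And>n. prob {w \<in> space M. chi n w = 1} = \<phi> n"
    and \<xi>_values: "\<And>n w. w \<in> space M \<Longrightarrow> 0 < \<xi> n w \<and> \<xi> n w < 1"
    and chi_indep: "indep_vars (\<lambda>_. borel) chi UNIV"
    and \<xi>_indep: "indep_vars (\<lambda>_. borel) \<xi> UNIV"
    and \<xi>_ident: "\<And>n. distr M borel (\<xi> n) = distr M borel (\<xi> 0)"
    and chi_\<xi>_indep: "indep_var (\<Pi>\<^sub>M n\<in>UNIV. borel) (\<lambda>w n. chi n w) (\<Pi>\<^sub>M n\<in>UNIV. borel) (\<lambda>w n. \<xi> n w)"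

definition env :: "real \<Rightarrow> (nat \<Rightarrow> 'a \<Rightarrow> real) \<Rightarrow> (nat \<Rightarrow> 'a \<Rightarrow> real) \<Rightarrow> 'a \<Rightarrow> nat \<Rightarrow> real" where
  "env \<delta> chi \<xi> w n = (1 - \<delta>) / 2 * chi n w + \<xi> n w * (1 - chi n w)"

definition zeta :: "(nat \<Rightarrow> 'a \<Rightarrow> real) \<Rightarrow> nat \<Rightarrow> 'a \<Rightarrow> real" where
  "zeta \<xi> n w = ln (\<xi> n w / (1 - \<xi> n w))"

text \<open>
  From \<open>n\<close> the walk steps to \<open>n - 1\<close> with probability \<open>p n\<close> and to \<open>n + 1\<close> otherwise. As \<open>0 - 1 = 0\<close>
  on \<^typ>\<open>nat\<close>, at the origin it stays put with probability \<open>p 0\<close>.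
\<close>

definition walk_kernel :: "(nat \<Rightarrow> real) \<Rightarrow> nat \<Rightarrow> nat pmf" where
  "walk_kernel p n = map_pmf (\<lambda>left. if left then n - 1 else n + 1) (bernoulli_pmf (p n))"

lemma pmf_walk_kernel:
  assumes "0 \<le> p n" "p n \<le> 1"
  shows "pmf (walk_kernel p n) (n - 1) = p n" "pmf (walk_kernel p n) (n + 1) = 1 - p n"
proof -
  have "(\<lambda>left. if left then n - 1 else n + 1) -` {n - 1} = {True}"
       "(\<lambda>left. if left then n - 1 else n + 1) -` {n + 1} = {False}"
    by (auto split: if_splits)
  then show "pmf (walk_kernel p n) (n - 1) = p n" "pmf (walk_kernel p n) (n + 1) = 1 - p n"
    using assms by (simp_all add: walk_kernel_def pmf_map measure_pmf_single)
qed

end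

theory Submission
  imports Defs
begin

text \<open>
  The walk is a birth-and-death chain, recurrent iff \<open>\<Sum>n. exp (S n)\<close> diverges, where \<open>S n\<close> is the sum
  of \<open>ln (p k / (1 - p k)) = (1 - \<chi> k) * \<zeta> k + c * \<chi> k\<close> over \<open>1 \<le> k \<le> n\<close> and
  \<open>c = ln ((1 - \<delta>) / (1 + \<delta>))\<close>. The mean of \<open>S n\<close> is of order \<open>c * n powr (1 - \<beta>)\<close>.
  For \<open>\<beta> < 1 / 2\<close> the centred sum is \<open>o(n powr (1 - \<beta>))\<close> almost surely, by a Rademacher--Menshov
  maximal inequality, so the sign of \<open>c\<close> decides. For \<open>\<beta> > 1 / 2\<close> the \<open>\<chi>\<close> terms are \<open>o(sqrt n)\<close> in
  \<open>L\<^sup>1\<close>, so by the central limit theorem \<open>S n \<ge> 0\<close> with probability bounded away from zero; hence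
  \<open>\<Sum>n. exp (S n)\<close> diverges with positive probability, and almost surely by Kolmogorov's 0--1 law.
\<close>

section \<open>Recurrence of birth-and-death chains\<close>

text \<open>Law of the first \<open>n + 1\<close> positions, built by prepending the start to a path
  from the next state. In this form first-step analysis is just \<open>bind_pmf\<close>, which the
  product-space construction of \<open>chain_law\<close> does not show directly.\<close>

primrec path_pmf :: "(nat \<Rightarrow> nat pmf) \<Rightarrow> nat \<Rightarrow> nat \<Rightarrow> nat list pmf" where
  "path_pmf K 0 y = return_pmf [y]"
| "path_pmf K (Suc n) y = bind_pmf (K y) (\<lambda>z. map_pmf (Cons y) (path_pmf K n z))"

lemma set_path_pmf:
  assumes "l \<in> set_pmf (path_pmf K n y)"
  shows "length l = Suc n" "l \<noteq> []" "hd l = y"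
proof -
  have "length l = Suc n \<and> hd l = y"
    using assms by (induction n arbitrary: y l) (auto simp: set_bind_pmf)
  then show "length l = Suc n" "l \<noteq> []" "hd l = y" by auto
qed

text \<open>The same product as in \<open>chain_law_path\<close>, which is what will identify the
  two constructions. The induction peels off the first state, so the rest of the path is
  \<open>a \<circ> Suc\<close>.\<close>

lemma pmf_path_pmf:
  "pmf (path_pmf K n y) (map a [0..<Suc n]) =
    (if a 0 = y then \<Prod>i<n. pmf (K (a i)) (a (Suc i)) else 0)"
proof (induction n arbitrary: y a)
  case 0
  show ?case by (auto simp: indicator_def)
next
  case (Suc n)
  define b where "b = a \<circ> Suc"
  have l: "map a [0..<Suc (Suc n)] = a 0 # map b [0..<Suc n]"
    by (subst upt_conv_Cons) (auto simp del: upt_Suc simp: b_def map_Suc_upt[symmetric])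
  have m: "pmf (map_pmf (Cons y) (path_pmf K n z)) (a 0 # map b [0..<Suc n]) =
      indicator {b 0} z * (if a 0 = y then \<Prod>i<n. pmf (K (b i)) (b (Suc i)) else 0)" for z
  proof (cases "a 0 = y")
    case True
    then show ?thesis
      using Suc.IH[of z b] by (auto simp del: upt_Suc simp: pmf_map_inj' indicator_def)
  next
    case False
    then have "a 0 # map b [0..<Suc n] \<notin> set_pmf (map_pmf (Cons y) (path_pmf K n z))"
      by (auto simp del: upt_Suc)
    then have "pmf (map_pmf (Cons y) (path_pmf K n z)) (a 0 # map b [0..<Suc n]) = 0"
      by (simp only: set_pmf_iff not_not)
    then show ?thesis using False by (simp del: upt_Suc)
  qed
  have "pmf (path_pmf K (Suc n) y) (map a [0..<Suc (Suc n)]) =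
      pmf (K y) (b 0) * (if a 0 = y then \<Prod>i<n. pmf (K (b i)) (b (Suc i)) else 0)"
    unfolding l path_pmf.simps pmf_bind m by (simp add: pmf.rep_eq)
  then show ?case
    by (simp add: b_def prod.lessThan_Suc_shift del: upt_Suc prod.lessThan_Suc)
qed

lemma prefix_vimage:
  "(\<lambda>X. map X [0..<Suc n]) -` {l} = (if length l = Suc n then {X. \<forall>i\<le>n. X i = l ! i} else {})"
proof -
  have "map X [0..<Suc n] = l \<longleftrightarrow> length l = Suc n \<and> (\<forall>i\<le>n. X i = l ! i)" for X
  proof -
    have "map X [0..<Suc n] = l \<longleftrightarrow>
        length l = Suc n \<and> (\<forall>i<Suc n. map X [0..<Suc n] ! i = l ! i)"
      unfolding list_eq_iff_nth_eq[of _ l] by (intro conj_cong) (simp_all del: upt_Suc, metis)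
    also have "\<dots> \<longleftrightarrow> length l = Suc n \<and> (\<forall>i\<le>n. X i = l ! i)"
      by (simp del: upt_Suc add: less_Suc_eq_le)
    finally show ?thesis .
  qed
  then show ?thesis by (auto simp del: upt_Suc)
qed

lemma measurable_prefix:
  "(\<lambda>X. map X [0..<Suc n]) \<in> measurable (chain_law K y) (count_space UNIV)"
  by (subst measurable_count_space_eq2_countable) (simp_all add: prefix_vimage sets_chain_law sets_path del: upt_Suc)

text \<open>Lists of naturals form a countable type, so it suffices that the two product formulas
  agree on singletons.\<close>

lemma distr_prefix_chain_law:
  "distr (chain_law K y) (count_space UNIV) (\<lambda>X. map X [0..<Suc n]) = measure_pmf (path_pmf K n y)"
  (is "distr ?M _ ?f = _")
proof (rule measure_eqI_countable[of _ UNIV])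
  interpret prob_space ?M by (rule prob_space_chain_law)
  fix l :: "nat list"
  have "emeasure (distr ?M (count_space UNIV) ?f) {l} = measure ?M (?f -` {l})"
    by (simp add: measurable_prefix emeasure_distr emeasure_eq_measure del: upt_Suc)
  also have "\<dots> = pmf (path_pmf K n y) l"
  proof (cases "length l = Suc n")
    case True
    then have "l = map ((!) l) [0..<Suc n]" by (metis map_nth)
    then show ?thesis
      using pmf_path_pmf[of K n y "(!) l"] True
      by (simp add: prefix_vimage chain_law_path del: upt_Suc)
  next
    case False
    then have "l \<notin> set_pmf (path_pmf K n y)" using set_path_pmf(1) by blast
    then show ?thesis using False by (simp add: prefix_vimage set_pmf_iff del: upt_Suc)
  qed
  finally show "emeasure (distr ?M (count_space UNIV) ?f) {l} = emeasure (measure_pmf (path_pmf K n y)) {l}"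
    by (simp add: emeasure_pmf_single del: upt_Suc)
qed auto

section \<open>Return probabilities within a finite horizon\<close>

lemma sets_hit: "{X. \<exists>t\<in>T. X t = x} \<in> sets (chain_law K y)"
proof -
  have "(\<lambda>X. X t) \<in> measurable (chain_law K y) (count_space UNIV)" for t
    unfolding measurable_cong_sets[OF sets_chain_law refl]
    by (rule measurable_component_singleton) simp
  then have "{X\<in>space (chain_law K y). \<exists>t\<in>T. X t = x} \<in> sets (chain_law K y)"
    by measurable
  then show ?thesis by simp
qed

text \<open>The start \<open>y\<close> is kept apart from the target \<open>x\<close> so that the
  first-step recursion closes. Time 0 is excluded, so for \<open>y = x\<close> a genuine return is
  counted.\<close>

definition return_upto :: "(nat \<Rightarrow> nat pmf) \<Rightarrow> nat \<Rightarrow> nat \<Rightarrow> nat \<Rightarrow> real" where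
  "return_upto K x n y = measure (chain_law K y) {X. \<exists>t\<in>{1..n}. X t = x}"

lemma return_upto_path_pmf:
  "return_upto K x n y = measure_pmf.prob (path_pmf K n y) {l. x \<in> set (tl l)}"
proof -
  let ?f = "\<lambda>X. map X [0..<Suc n]"
  have "measure_pmf.prob (path_pmf K n y) {l. x \<in> set (tl l)} =
      measure (chain_law K y) (?f -` {l. x \<in> set (tl l)})"
    unfolding distr_prefix_chain_law[symmetric] by (simp add: measurable_prefix measure_distr del: upt_Suc)
  also have "?f -` {l. x \<in> set (tl l)} = {X. \<exists>t\<in>{1..n}. X t = x}"
  proof -
    have "set (tl (map X [0..<Suc n])) = X ` {1..n}" for X
      by (subst upt_conv_Cons) (auto simp del: upt_Suc)
    then have "x \<in> set (tl (map X [0..<Suc n])) \<longleftrightarrow> (\<exists>t\<in>{1..n}. X t = x)" for X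
      by (metis image_iff)
    then show ?thesis unfolding vimage_def by (simp only: mem_Collect_eq)
  qed
  finally show ?thesis by (simp add: return_upto_def)
qed

lemma return_upto_0 [simp]: "return_upto K x 0 y = 0"
  by (simp add: return_upto_def)

text \<open>First-step analysis: after the move to \<open>z\<close>, either the target is hit at
  once or \<open>n\<close> steps from \<open>z\<close> remain.\<close>

lemma return_upto_Suc:
  "return_upto K x (Suc n) y = measure_pmf.expectation (K y) (\<lambda>z. if z = x then 1 else return_upto K x n z)"
proof -
  have "return_upto K x (Suc n) y =
      measure_pmf.expectation (K y) (\<lambda>z. measure_pmf.prob (map_pmf (Cons y) (path_pmf K n z)) {l. x \<in> set (tl l)})"
    unfolding return_upto_path_pmf path_pmf.simps
    unfolding measure_pmf_bind
    by (rule measure_pmf.measure_bind[where N = "count_space UNIV"])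
      (simp_all add: measurable_measure_pmf[unfolded measurable_count_space_eq1])
  also have "\<dots> = measure_pmf.expectation (K y) (\<lambda>z. if z = x then 1 else return_upto K x n z)"
  proof (rule Bochner_Integration.integral_cong[OF refl])
    fix z
    \<comment> \<open>A path from \<open>z\<close> begins with \<open>z\<close>, so \<open>x\<close>
      occurs in it either at the head or in the tail.\<close>
    have "measure_pmf.prob (path_pmf K n z) {l. x \<in> set l} =
        measure_pmf.prob (path_pmf K n z) {l. z = x \<or> x \<in> set (tl l)}"
    proof (rule measure_pmf.finite_measure_eq_AE)
      show "AE l in path_pmf K n z. (l \<in> {l. x \<in> set l}) = (l \<in> {l. z = x \<or> x \<in> set (tl l)})"
      proof (rule AE_pmfI)
        fix l assume "l \<in> set_pmf (path_pmf K n z)"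
        then have "l = z # tl l" using set_path_pmf by (metis list.collapse)
        then have "set l = insert z (set (tl l))" by (metis list.simps(15))
        then show "(l \<in> {l. x \<in> set l}) = (l \<in> {l. z = x \<or> x \<in> set (tl l)})" by auto
      qed
    qed auto
    then show "measure_pmf.prob (map_pmf (Cons y) (path_pmf K n z)) {l. x \<in> set (tl l)} =
        (if z = x then 1 else return_upto K x n z)"
      by (simp add: return_upto_path_pmf vimage_def)
  qed
  finally show ?thesis .
qed

lemma return_upto_bounds: "0 \<le> return_upto K x n y" "return_upto K x n y \<le> 1"
  by (simp_all add: return_upto_def prob_space.prob_le_1[OF prob_space_chain_law])

lemma incseq_return_upto: "incseq (\<lambda>n. return_upto K x n y)"
proof (rule incseq_SucI)
  interpret prob_space "chain_law K y" by (rule prob_space_chain_law)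
  show "return_upto K x n y \<le> return_upto K x (Suc n) y" for n
    unfolding return_upto_def by (rule finite_measure_mono[OF _ sets_hit]) auto
qed

lemma return_upto_tendsto: "(\<lambda>n. return_upto K x n x) \<longlonglongrightarrow> return_prob K x"
proof -
  interpret prob_space "chain_law K x" by (rule prob_space_chain_law)
  define E where "E n = {X :: nat \<Rightarrow> nat. \<exists>t\<in>{1..n}. X t = x}" for n :: nat
  have "E n \<subseteq> E (Suc n)" for n
  proof
    fix X assume "X \<in> E n"
    then obtain t where "t \<in> {1..n}" "X t = x" unfolding E_def by blast
    then have "t \<in> {1..Suc n}" "X t = x" by simp_all
    then show "X \<in> E (Suc n)" unfolding E_def by blast
  qed
  moreover have "E n \<in> sets (chain_law K x)" for n
    unfolding E_def by (rule sets_hit)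
  ultimately have "(\<lambda>n. measure (chain_law K x) (E n)) \<longlonglongrightarrow> measure (chain_law K x) (\<Union>n. E n)"
    by (intro finite_Lim_measure_incseq incseq_SucI) auto
  also have "(\<Union>n. E n) = {X. \<exists>t\<ge>1. X t = x}" unfolding E_def by fastforce
  finally show ?thesis by (simp add: return_prob_def return_upto_def E_def)
qed

text \<open>The increments of a harmonic function of the walk above its target are proportional to these
  products.\<close>

definition odds_prod :: "(nat \<Rightarrow> real) \<Rightarrow> nat \<Rightarrow> real" where
  "odds_prod p n = (\<Prod>k=1..n. p k / (1 - p k))"

section \<open>Harmonic functions and the recurrence criterion\<close>

locale nondegenerate_walk =
  fixes p :: "nat \<Rightarrow> real"
  assumes p_bounds: "\<And>n. 0 < p n" "\<And>n. p n < 1"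
begin

lemma expectation_walk_kernel:
  fixes f :: "nat \<Rightarrow> real"
  shows "measure_pmf.expectation (walk_kernel p n) f = p n * f (n - 1) + (1 - p n) * f (n + 1)"
  using p_bounds[of n] by (simp add: walk_kernel_def)

lemma odds_prod_pos: "0 < odds_prod p n"
  unfolding odds_prod_def using p_bounds by (intro prod_pos) auto

lemma odds_prod_Suc: "(1 - p (Suc n)) * odds_prod p (Suc n) = p (Suc n) * odds_prod p n"
  unfolding odds_prod_def using p_bounds(2)[of "Suc n"] by (simp add: field_simps)

text \<open>\<open>h y\<close> is the probability of ever visiting \<open>x\<close> from \<open>y\<close>.\<close>

lemma return_prob_walk_eq:
  obtains h where "h x = 1" "\<And>y. 0 \<le> h y" "\<And>y. h y \<le> 1"
    "\<And>y. y \<noteq> x \<Longrightarrow> h y = p y * h (y - 1) + (1 - p y) * h (y + 1)"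
    "return_prob (walk_kernel p) x = p x * h (x - 1) + (1 - p x) * h (x + 1)"
    "\<And>y. y \<noteq> x \<Longrightarrow> (\<lambda>n. return_upto (walk_kernel p) x n y) \<longlonglongrightarrow> h y"
proof -
  let ?G = "return_upto (walk_kernel p) x"
  have "\<exists>L. (\<lambda>n. ?G n y) \<longlonglongrightarrow> L" for y
    using incseq_convergent[OF incseq_return_upto, of "walk_kernel p" x y 1] return_upto_bounds(2) by metis
  then obtain g where g: "\<And>y. (\<lambda>n. ?G n y) \<longlonglongrightarrow> g y" by metis
  \<comment> \<open>\<open>g x\<close> is the return probability, whereas visiting \<open>x\<close>
    from \<open>x\<close> is certain. Replacing that one value by 1 expresses the recursion for
    \<open>g\<close> in terms of \<open>h\<close> alone.\<close>
  define h where "h y = (if y = x then 1 else g y)" for y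
  have lim: "(\<lambda>n. if y = x then 1 else ?G n y) \<longlonglongrightarrow> h y" for y
    using g by (simp add: h_def)
  have g_eq: "g y = p y * h (y - 1) + (1 - p y) * h (y + 1)" for y
  proof (rule LIMSEQ_unique)
    show "(\<lambda>n. ?G (Suc n) y) \<longlonglongrightarrow> g y" using g by (rule LIMSEQ_Suc)
    show "(\<lambda>n. ?G (Suc n) y) \<longlonglongrightarrow> p y * h (y - 1) + (1 - p y) * h (y + 1)"
      unfolding return_upto_Suc expectation_walk_kernel by (intro tendsto_intros lim)
  qed
  show thesis
  proof (rule that[of h])
    show "0 \<le> h y" for y
      using LIMSEQ_le_const[OF g, of 0 y] return_upto_bounds(1) by (auto simp: h_def)
    show "h y \<le> 1" for y
      using LIMSEQ_le_const2[OF g, of y 1] return_upto_bounds(2) by (auto simp: h_def)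
    show "return_prob (walk_kernel p) x = p x * h (x - 1) + (1 - p x) * h (x + 1)"
      unfolding g_eq[symmetric] by (rule LIMSEQ_unique[OF return_upto_tendsto g])
  qed (use g_eq g in \<open>auto simp: h_def\<close>)
qed

text \<open>The visiting probability \<open>h\<close> is harmonic off \<open>x\<close>. Above
  \<open>x\<close> its increments are a constant \<open>D\<close> times \<open>odds_prod p\<close>;
  a divergent sum of these contradicts \<open>0 \<le> h \<le> 1\<close> unless
  \<open>D = 0\<close>.\<close>

lemma recurrent_if_not_summable:
  assumes "\<not> summable (odds_prod p)"
  shows "recurrent_chain (walk_kernel p)"
  unfolding recurrent_chain_def
proof
  fix x
  obtain h where h: "h x = 1" "\<And>y. 0 \<le> h y" "\<And>y. h y \<le> 1"
    "\<And>y. y \<noteq> x \<Longrightarrow> h y = p y * h (y - 1) + (1 - p y) * h (y + 1)"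
    "return_prob (walk_kernel p) x = p x * h (x - 1) + (1 - p x) * h (x + 1)"
    using return_prob_walk_eq[of x] by metis
  \<comment> \<open>Staying put at 0 forces the first increment of \<open>h\<close> to vanish, and
    harmonicity carries this up to \<open>x\<close>.\<close>
  have below: "y < x \<Longrightarrow> h (Suc y) = h y" for y
  proof (induction y)
    case 0
    then have "(1 - p 0) * (h 1 - h 0) = 0" using h(4)[of 0] by (simp add: algebra_simps)
    then show ?case using p_bounds(2)[of 0] by simp
  next
    case (Suc y)
    then have "(1 - p (Suc y)) * (h (Suc (Suc y)) - h (Suc y)) = 0"
      using h(4)[of "Suc y"] by (simp add: algebra_simps)
    then show ?case using p_bounds(2)[of "Suc y"] by simp
  qed
  \<comment> \<open>For \<open>x = 0\<close> this rests on \<open>0 - 1 = 0\<close>.\<close>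
  have left: "h (x - 1) = 1"
    using below[of "x - 1"] h(1) by (cases x) auto
  define D where "D = (h (Suc x) - h x) / odds_prod p x"
  have incr: "h (Suc (x + k)) - h (x + k) = D * odds_prod p (x + k)" for k
  proof (induction k)
    case 0
    then show ?case using odds_prod_pos[of x] by (simp add: D_def)
  next
    case (Suc k)
    let ?y = "Suc (x + k)"
    have "(1 - p ?y) * (h (Suc ?y) - h ?y) = p ?y * (h ?y - h (x + k))"
      using h(4)[of ?y] by (simp add: algebra_simps)
    also have "\<dots> = D * (p ?y * odds_prod p (x + k))"
      using Suc.IH by simp
    also have "\<dots> = (1 - p ?y) * (D * odds_prod p ?y)"
      unfolding odds_prod_Suc[symmetric] by simp
    finally show ?case using p_bounds(2)[of ?y] by simp
  qed
  have sum: "h (x + n) - h x = D * (\<Sum>k<n. odds_prod p (x + k))" for n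
    by (induction n) (use incr in \<open>auto simp: algebra_simps\<close>)
  have "D = 0"
  proof (rule ccontr)
    assume "D \<noteq> 0"
    have "(\<Sum>k<n. odds_prod p (x + k)) \<le> 1 / \<bar>D\<bar>" for n
    proof -
      have "\<bar>D\<bar> * (\<Sum>k<n. odds_prod p (x + k)) = \<bar>h (x + n) - h x\<bar>"
        unfolding sum abs_mult using odds_prod_pos by (simp add: sum_nonneg less_imp_le)
      also have "\<dots> \<le> 1" using h(1) h(2,3)[of "x + n"] by simp
      finally show ?thesis using \<open>D \<noteq> 0\<close> by (simp add: field_simps)
    qed
    then have "summable (\<lambda>k. odds_prod p (x + k))"
      by (intro summableI_nonneg_bounded[of _ "1 / \<bar>D\<bar>"]) (simp_all add: odds_prod_pos less_imp_le)
    then show False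
      using assms summable_iff_shift[of "odds_prod p" x] by (simp add: add.commute)
  qed
  then have "h (x + 1) = 1" using incr[of 0] h(1) by simp
  then show "return_prob (walk_kernel p) x = 1" using h(5) left by simp
qed

text \<open>The tails \<open>r\<close> of the convergent series yield a function \<open>g\<close>
  that is superharmonic off \<open>x\<close>, equals 1 up to \<open>x\<close> and is below 1 beyond.
  It dominates the visiting probabilities, so a step to \<open>x + 1\<close> has a positive chance
  of escape.\<close>

lemma transient_if_summable:
  assumes "summable (odds_prod p)"
  shows "transient_chain (walk_kernel p)"
  unfolding transient_chain_def
proof
  fix x
  define r where "r y = (\<Sum>k. odds_prod p (y + k))" for y
  have sm: "summable (\<lambda>k. odds_prod p (y + k))" for y
    using assms summable_iff_shift[of "odds_prod p" y] by (simp add: add.commute)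
  have r_pos: "0 < r y" for y
    unfolding r_def using sm odds_prod_pos by (rule suminf_pos)
  have r_Suc: "r y = odds_prod p y + r (Suc y)" for y
    unfolding r_def using suminf_split_head[OF sm, of y] by simp
  define g where "g y = (if y \<le> x then 1 else r y / r x)" for y
  have g_nonneg: "0 \<le> g y" for y using r_pos by (simp add: g_def less_imp_le)
  have g_x: "g x = 1" by (simp add: g_def)
  have super: "p y * g (y - 1) + (1 - p y) * g (y + 1) \<le> g y" if "y \<noteq> x" for y
  proof (cases "y < x")
    case True
    then have "g (y - 1) = 1" "g (y + 1) = 1" "g y = 1" by (auto simp: g_def)
    then show ?thesis by simp
  next
    case False
    with that obtain z where z: "y = Suc z" "x \<le> z" by (cases y) auto
    have g': "g k = r k / r x" if "x \<le> k" for k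
      using that r_pos[of x] by (cases "k = x") (auto simp: g_def)
    \<comment> \<open>Inserting the two tail recursions leaves
      \<open>p y * odds_prod p z = (1 - p y) * odds_prod p y\<close>, so \<open>g\<close> is in fact
      harmonic above \<open>x\<close>.\<close>
    have "p y * r z + (1 - p y) * r (Suc y) = r y"
      using odds_prod_Suc[of z] r_Suc[of z] r_Suc[of y] by (simp add: z(1) algebra_simps)
    then have "p y * (r z / r x) + (1 - p y) * (r (Suc y) / r x) = r y / r x"
      by (metis add_divide_distrib times_divide_eq_right)
    then show ?thesis using z by (simp add: g')
  qed
  \<comment> \<open>Superharmonicity propagates the bound through each first step; it then passes to
    the limit \<open>h\<close>.\<close>
  have le: "(if y = x then 1 else return_upto (walk_kernel p) x n y) \<le> g y" for n y
  proof (induction n arbitrary: y)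
    case 0
    then show ?case using g_nonneg[of y] g_x by simp
  next
    case (Suc n)
    show ?case
    proof (cases "y = x")
      case False
      have "return_upto (walk_kernel p) x (Suc n) y \<le> p y * g (y - 1) + (1 - p y) * g (y + 1)"
        unfolding return_upto_Suc expectation_walk_kernel using p_bounds[of y]
        by (intro add_mono mult_left_mono Suc.IH) auto
      then show ?thesis using super[OF False] False by simp
    qed (simp add: g_def)
  qed
  obtain h where h: "\<And>y. h y \<le> 1"
    "return_prob (walk_kernel p) x = p x * h (x - 1) + (1 - p x) * h (x + 1)"
    "\<And>y. y \<noteq> x \<Longrightarrow> (\<lambda>n. return_upto (walk_kernel p) x n y) \<longlonglongrightarrow> h y"
    using return_prob_walk_eq[of x] by metis
  have "h (x + 1) \<le> g (x + 1)"
    using le[of "x + 1"] by (intro LIMSEQ_le_const2[OF h(3)]) auto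
  also have "\<dots> < 1" using r_Suc[of x] odds_prod_pos[of x] r_pos[of x] by (simp add: g_def)
  finally have "p x * h (x - 1) + (1 - p x) * h (x + 1) < p x * 1 + (1 - p x) * 1"
    using p_bounds[of x] h(1)[of "x - 1"] by (intro add_le_less_mono mult_left_mono mult_strict_left_mono) auto
  then show "return_prob (walk_kernel p) x < 1" by (simp add: h(2))
qed

end

section \<open>A strong law for orthogonal sequences\<close>

text \<open>Besides the squares of single values, each dyadic sub-block contributes the square of
  the sum over its left half. Right halves are absent: an initial segment of a block splits into
  left halves and at most one last point.\<close>

primrec dyadic_squares :: "(nat \<Rightarrow> real) \<Rightarrow> nat \<Rightarrow> nat \<Rightarrow> real" where
  "dyadic_squares f 0 a = (f a)\<^sup>2"
| "dyadic_squares f (Suc m) a =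
    dyadic_squares f m a + dyadic_squares f m (a + 2 ^ m) + (\<Sum>i=a..<a + 2 ^ m. f i)\<^sup>2"

lemma dyadic_squares_nonneg: "0 \<le> dyadic_squares f m a"
  by (induction m arbitrary: a) auto

text \<open>The difference of the two sides is a square divided by \<open>t\<close>. Later
  \<open>t\<close> is the depth of a dyadic block.\<close>

lemma power2_sum_weighted:
  fixes x y t :: real
  assumes "0 < t"
  shows "(x + y)\<^sup>2 \<le> (t + 1) * x\<^sup>2 + (1 + 1 / t) * y\<^sup>2"
proof -
  have "(t + 1) * x\<^sup>2 + (1 + 1 / t) * y\<^sup>2 - (x + y)\<^sup>2 = (t * x - y)\<^sup>2 / t"
    using assms by (simp add: field_simps power2_eq_square)
  also have "\<dots> \<ge> 0" using assms by simp
  finally show ?thesis by simp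
qed

text \<open>The recursion behind the Rademacher--Menshov inequality: halving a block of length
  \<open>2 ^ (m + 1)\<close> and weighting the two parts by \<open>m + 1\<close> costs only one unit of the factor \<open>m + 1\<close>.\<close>

lemma partial_sum_le_dyadic_squares:
  assumes "n \<le> 2 ^ m"
  shows "(\<Sum>i=a..<a + n. f i)\<^sup>2 \<le> real (m + 1) * dyadic_squares f m a"
  using assms
proof (induction m arbitrary: a n)
  case 0
  then consider "n = 0" | "n = 1" by fastforce
  then show ?case by cases auto
next
  case (Suc m)
  let ?D = "dyadic_squares f m" and ?S = "\<Sum>i=a..<a + 2 ^ m. f i"
  show ?case
  proof (cases "n \<le> 2 ^ m")
    case True
    have "(\<Sum>i=a..<a + n. f i)\<^sup>2 \<le> real (m + 1) * ?D a" by (rule Suc.IH[OF True])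
    also have "\<dots> \<le> real (Suc m + 1) * dyadic_squares f (Suc m) a"
      using dyadic_squares_nonneg[of f m] by (intro mult_mono) auto
    finally show ?thesis .
  next
    case False
    then have n: "n - 2 ^ m \<le> 2 ^ m" "a + n = (a + 2 ^ m) + (n - 2 ^ m)"
      using Suc.prems by auto
    let ?R = "\<Sum>i=a + 2 ^ m..<a + n. f i"
    have "(\<Sum>i=a..<a + n. f i) = ?S + ?R"
      using False by (intro sum.atLeastLessThan_concat[symmetric]) auto
    then have "(\<Sum>i=a..<a + n. f i)\<^sup>2 \<le>
        (real (m + 1) + 1) * ?S\<^sup>2 + (1 + 1 / real (m + 1)) * ?R\<^sup>2"
      using power2_sum_weighted[of "real (m + 1)" ?S ?R] by simp
    also have "?R\<^sup>2 \<le> real (m + 1) * ?D (a + 2 ^ m)"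
      unfolding n(2) by (rule Suc.IH[OF n(1)])
    also have "(1 + 1 / real (m + 1)) * (real (m + 1) * ?D (a + 2 ^ m)) = real (m + 2) * ?D (a + 2 ^ m)"
      by (simp add: field_simps)
    also have "(real (m + 1) + 1) * ?S\<^sup>2 + real (m + 2) * ?D (a + 2 ^ m) \<le>
        real (Suc m + 1) * dyadic_squares f (Suc m) a"
      using dyadic_squares_nonneg[of f m a] by (simp add: algebra_simps)
    finally show ?thesis by (simp add: mult_left_mono)
  qed
qed

text \<open>Differentiating the geometric series twice gives coefficients
  \<open>(n + 1) * (n + 2)\<close>, which dominate \<open>(n + 1) ^ 2\<close>.\<close>

lemma summable_square_mult_power:
  fixes x :: real
  assumes "\<bar>x\<bar> < 1"
  shows "summable (\<lambda>n. real (n + 1) ^ 2 * x ^ n)"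
proof -
  have "summable (\<lambda>n. diffs (\<lambda>_. 1 :: real) n * y ^ n)" if "norm y < 1" for y :: real
    by (rule termdiff_converges[OF that]) (simp add: summable_geometric)
  then have "summable (\<lambda>n. diffs (diffs (\<lambda>_. 1 :: real)) n * \<bar>x\<bar> ^ n)"
    using assms by (intro termdiff_converges[of _ 1]) auto
  then have "summable (\<lambda>n. (real n + 1) * (real n + 2) * \<bar>x\<bar> ^ n)"
    by (simp add: diffs_def algebra_simps)
  then show ?thesis
  proof (rule summable_comparison_test')
    fix n :: nat
    show "norm (real (n + 1) ^ 2 * x ^ n) \<le> (real n + 1) * (real n + 2) * \<bar>x\<bar> ^ n"
      unfolding real_norm_def abs_mult power_abs power2_eq_square
      by (intro mult_right_mono mult_mono) auto
  qed
qed

text \<open>By monotone convergence the series of the \<open>Y m\<close> has finite expectation;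
  hence it converges almost surely and its terms vanish.\<close>

lemma (in prob_space) AE_tendsto_0_if_summable_expectation:
  fixes Y :: "nat \<Rightarrow> 'a \<Rightarrow> real"
  assumes "\<And>m. integrable M (Y m)" "\<And>m w. 0 \<le> Y m w" "summable (\<lambda>m. expectation (Y m))"
  shows "AE w in M. (\<lambda>m. Y m w) \<longlonglongrightarrow> 0"
proof -
  have [measurable]: "Y m \<in> borel_measurable M" for m using assms(1) by auto
  have "(\<integral>\<^sup>+w. (\<Sum>m. ennreal (Y m w)) \<partial>M) = (\<Sum>m. ennreal (expectation (Y m)))"
    by (subst nn_integral_suminf) (auto simp: nn_integral_eq_integral assms)
  also have "\<dots> \<noteq> \<infinity>"
    using assms by (subst suminf_ennreal2) (auto simp: Bochner_Integration.integral_nonneg)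
  finally have "AE w in M. (\<Sum>m. ennreal (Y m w)) \<noteq> \<infinity>"
    by (intro nn_integral_PInf_AE) auto
  then show ?thesis
  proof (rule AE_mp, intro AE_I2 impI)
    fix w assume "(\<Sum>m. ennreal (Y m w)) \<noteq> \<infinity>"
    then have "summable (\<lambda>m. Y m w)" using assms(2) by (intro summable_suminf_not_top) auto
    then show "(\<lambda>m. Y m w) \<longlonglongrightarrow> 0" by (rule summable_LIMSEQ_zero)
  qed
qed

section \<open>Partial sums of orthogonal sequences\<close>

locale orthogonal_sequence = prob_space M for M :: "'a measure" +
  fixes X :: "nat \<Rightarrow> 'a \<Rightarrow> real" and C :: real
  assumes X_measurable [measurable]: "\<And>i. X i \<in> borel_measurable M"
    and X_square: "\<And>i. integrable M (\<lambda>w. (X i w)\<^sup>2)"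
    and X_orth: "\<And>i j. i \<noteq> j \<Longrightarrow> expectation (\<lambda>w. X i w * X j w) = 0"
    and X_bound: "\<And>i. expectation (\<lambda>w. (X i w)\<^sup>2) \<le> C"
begin

lemma C_nonneg: "0 \<le> C"
  by (rule order_trans[OF _ X_bound[of 0]]) simp

lemma integrable_mult: "integrable M (\<lambda>w. X i w * X j w)"
proof (rule Bochner_Integration.integrable_bound)
  show "integrable M (\<lambda>w. (X i w)\<^sup>2 + (X j w)\<^sup>2)" using X_square by auto
  show "AE w in M. norm (X i w * X j w) \<le> norm ((X i w)\<^sup>2 + (X j w)\<^sup>2)"
  proof (rule AE_I2)
    fix w
    have "2 * (\<bar>X i w\<bar> * \<bar>X j w\<bar>) \<le> (X i w)\<^sup>2 + (X j w)\<^sup>2"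
      using sum_squares_bound[of "\<bar>X i w\<bar>" "\<bar>X j w\<bar>"] by simp
    moreover have "0 \<le> \<bar>X i w\<bar> * \<bar>X j w\<bar>" by simp
    ultimately show "norm (X i w * X j w) \<le> norm ((X i w)\<^sup>2 + (X j w)\<^sup>2)"
      unfolding real_norm_def abs_mult by linarith
  qed
qed simp

lemma sum_square:
  assumes "finite I"
  shows "integrable M (\<lambda>w. (\<Sum>i\<in>I. X i w)\<^sup>2)"
    and "expectation (\<lambda>w. (\<Sum>i\<in>I. X i w)\<^sup>2) \<le> C * real (card I)"
proof -
  have eq: "(\<lambda>w. (\<Sum>i\<in>I. X i w)\<^sup>2) = (\<lambda>w. \<Sum>i\<in>I. \<Sum>j\<in>I. X i w * X j w)"
    by (simp add: power2_eq_square sum_product)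
  show "integrable M (\<lambda>w. (\<Sum>i\<in>I. X i w)\<^sup>2)"
    unfolding eq by (intro Bochner_Integration.integrable_sum integrable_mult)
  have "expectation (\<lambda>w. (\<Sum>i\<in>I. X i w)\<^sup>2) = (\<Sum>i\<in>I. \<Sum>j\<in>I. expectation (\<lambda>w. X i w * X j w))"
    unfolding eq by (simp add: integrable_mult)
  also have "\<dots> = (\<Sum>i\<in>I. expectation (\<lambda>w. (X i w)\<^sup>2))"
  proof (rule sum.cong[OF refl])
    fix i assume "i \<in> I"
    then have "(\<Sum>j\<in>I. expectation (\<lambda>w. X i w * X j w)) = (\<Sum>j\<in>{i}. expectation (\<lambda>w. X i w * X j w))"
      using assms X_orth by (intro sum.mono_neutral_right) auto
    then show "(\<Sum>j\<in>I. expectation (\<lambda>w. X i w * X j w)) = expectation (\<lambda>w. (X i w)\<^sup>2)"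
      by (simp add: power2_eq_square)
  qed
  also have "\<dots> \<le> (\<Sum>i\<in>I. C)" by (intro sum_mono X_bound)
  finally show "expectation (\<lambda>w. (\<Sum>i\<in>I. X i w)\<^sup>2) \<le> C * real (card I)" by (simp add: mult.commute)
qed

text \<open>By orthogonality the disjoint blocks of one level contribute at most \<open>C\<close>
  per index, hence at most \<open>C * 2 ^ m\<close>, and there are \<open>m + 1\<close>
  levels.\<close>

lemma dyadic_squares_expectation:
  shows "integrable M (\<lambda>w. dyadic_squares (\<lambda>i. X i w) m a)"
    and "expectation (\<lambda>w. dyadic_squares (\<lambda>i. X i w) m a) \<le> C * real (m + 1) * 2 ^ m"
proof -
  have "integrable M (\<lambda>w. dyadic_squares (\<lambda>i. X i w) m a) \<and>
      expectation (\<lambda>w. dyadic_squares (\<lambda>i. X i w) m a) \<le> C * real (m + 1) * 2 ^ m"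
  proof (induction m arbitrary: a)
    case 0
    then show ?case using X_square X_bound by simp
  next
    case (Suc m)
    have "expectation (\<lambda>w. dyadic_squares (\<lambda>i. X i w) (Suc m) a) \<le>
        C * real (m + 1) * 2 ^ m + C * real (m + 1) * 2 ^ m + C * 2 ^ m"
      using Suc.IH[of a] Suc.IH[of "a + 2 ^ m"] sum_square[of "{a..<a + 2 ^ m}"] by simp
    also have "\<dots> \<le> C * real (Suc m + 1) * 2 ^ Suc m"
      using C_nonneg by (simp add: algebra_simps)
    finally show ?case
      using Suc.IH[of a] Suc.IH[of "a + 2 ^ m"] sum_square[of "{a..<a + 2 ^ m}"] by simp
  qed
  then show "integrable M (\<lambda>w. dyadic_squares (\<lambda>i. X i w) m a)"
    "expectation (\<lambda>w. dyadic_squares (\<lambda>i. X i w) m a) \<le> C * real (m + 1) * 2 ^ m" by auto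
qed

text \<open>\<open>Y m\<close> bounds all squared partial sums up to length \<open>2 ^ m\<close>,
  relative to \<open>q ^ m\<close>. Its expectation is at most
  \<open>C * (m + 1) ^ 2 * (2 / q) ^ m\<close>, which is summable, so \<open>Y m\<close> tends to 0
  almost surely; every \<open>n\<close> is then covered by a dyadic block.\<close>

lemma strong_law:
  assumes "1 / 2 < \<alpha>"
  shows "AE w in M. (\<lambda>n. (\<Sum>i=1..n. X i w) / real n powr \<alpha>) \<longlonglongrightarrow> 0"
proof -
  \<comment> \<open>The factor by which the square of \<open>n powr \<alpha>\<close> grows when
    \<open>n\<close> doubles; it exceeds 2 exactly because \<alpha> exceeds 1/2.\<close>
  define q where "q = 2 powr (2 * \<alpha>)"
  have q: "2 < q" using assms powr_less_mono[of 1 "2 * \<alpha>" 2] by (simp add: q_def)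
  define Y where "Y m w = real (m + 1) * dyadic_squares (\<lambda>i. X i w) m 1 / q ^ m" for m w
  have Y_nonneg: "0 \<le> Y m w" for m w
    using q dyadic_squares_nonneg by (simp add: Y_def)
  have int: "integrable M (Y m)" for m
    unfolding Y_def using dyadic_squares_expectation(1) by auto
  have le: "expectation (Y m) \<le> C * (real (m + 1) ^ 2 * (2 / q) ^ m)" for m
  proof -
    have "expectation (Y m) = real (m + 1) * expectation (\<lambda>w. dyadic_squares (\<lambda>i. X i w) m 1) / q ^ m"
      unfolding Y_def using dyadic_squares_expectation(1) by simp
    also have "\<dots> \<le> real (m + 1) * (C * real (m + 1) * 2 ^ m) / q ^ m"
      using q by (intro divide_right_mono mult_left_mono dyadic_squares_expectation(2)) auto
    finally show ?thesis by (simp add: power2_eq_square power_divide mult_ac)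
  qed
  have "summable (\<lambda>m. expectation (Y m))"
  proof (rule summable_comparison_test')
    have "summable (\<lambda>m. real (m + 1) ^ 2 * (2 / q) ^ m)"
      using q by (intro summable_square_mult_power) simp
    then show "summable (\<lambda>m. C * (real (m + 1) ^ 2 * (2 / q) ^ m))" by (intro summable_mult) simp
    show "norm (expectation (Y m)) \<le> C * (real (m + 1) ^ 2 * (2 / q) ^ m)" if "0 \<le> m" for m
      using le[of m] Y_nonneg by (simp add: Bochner_Integration.integral_nonneg)
  qed
  then have "AE w in M. (\<lambda>m. Y m w) \<longlonglongrightarrow> 0"
    by (intro AE_tendsto_0_if_summable_expectation int Y_nonneg)
  then show ?thesis
  proof (rule AE_mp, intro AE_I2 impI)
    fix w assume lim: "(\<lambda>m. Y m w) \<longlonglongrightarrow> 0"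
    show "(\<lambda>n. (\<Sum>i=1..n. X i w) / real n powr \<alpha>) \<longlonglongrightarrow> 0"
    proof (rule LIMSEQ_I)
      fix r :: real assume "0 < r"
      \<comment> \<open>The division by \<open>q\<close> pays for passing from
        \<open>2 ^ m \<le> n\<close> to the enclosing block of length
        \<open>2 ^ (m + 1)\<close>.\<close>
      then have "0 < r\<^sup>2 / q" using q by simp
      from LIMSEQ_D[OF lim this] obtain N where N: "\<And>m. N \<le> m \<Longrightarrow> Y m w < r\<^sup>2 / q"
        using Y_nonneg by auto
      have "norm ((\<Sum>i=1..n. X i w) / real n powr \<alpha> - 0) < r" if n: "2 ^ N \<le> n" for n
      proof -
        let ?T = "\<Sum>i=1..n. X i w"
        have n1: "1 \<le> n" using n by (metis le_trans one_le_numeral one_le_power)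
        then obtain m where m: "2 ^ m \<le> n" "n < 2 ^ (m + 1)"
          using ex_power_ivl1[of 2 n] by auto
        have "N \<le> m + 1"
        proof -
          have "(2::nat) ^ N < 2 ^ (m + 1)" using n m(2) by simp
          then show ?thesis using power_less_imp_less_exp[of "2 :: nat" N "m + 1"] by simp
        qed
        have qm: "q ^ m \<le> (real n powr \<alpha>)\<^sup>2"
        proof -
          have "q ^ m = (2 powr real m) powr (2 * \<alpha>)"
            by (simp add: q_def powr_powr powr_power mult.commute)
          also have "\<dots> \<le> real n powr (2 * \<alpha>)"
            using m(1) assms by (intro powr_mono2) (auto simp: powr_realpow simp flip: of_nat_power)
          also have "\<dots> = (real n powr \<alpha>)\<^sup>2" using n1 by (simp add: powr_power mult.commute)
          finally show ?thesis .
        qed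
        have "?T\<^sup>2 = (\<Sum>i=1..<1 + n. X i w)\<^sup>2"
          by (simp add: atLeastLessThanSuc_atLeastAtMost)
        also have "\<dots> \<le> real (m + 1 + 1) * dyadic_squares (\<lambda>i. X i w) (m + 1) 1"
          using m by (intro partial_sum_le_dyadic_squares) auto
        also have "\<dots> = Y (m + 1) w * q ^ (m + 1)"
          using q by (simp add: Y_def)
        also have "\<dots> < r\<^sup>2 / q * q ^ (m + 1)"
          using N[OF \<open>N \<le> m + 1\<close>] q by (intro mult_strict_right_mono) auto
        also have "\<dots> = r\<^sup>2 * q ^ m" using q by simp
        also have "\<dots> \<le> r\<^sup>2 * (real n powr \<alpha>)\<^sup>2" by (intro mult_left_mono qm) auto
        finally have "\<bar>?T\<bar> < r * real n powr \<alpha>"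
          using \<open>0 < r\<close> by (auto intro: power2_less_imp_less simp: power_mult_distrib)
        then show ?thesis using n1 by (simp add: field_simps abs_divide)
      qed
      then show "\<exists>n0. \<forall>n\<ge>n0. norm ((\<Sum>i=1..n. X i w) / real n powr \<alpha> - 0) < r" by blast
    qed
  qed
qed

end

section \<open>Zero--one law, symmetry, Gaussian tail\<close>

text \<open>Divergence of the series is a tail event of the independent \<open>U i\<close>, so
  Kolmogorov's law applies.\<close>

lemma (in prob_space) not_summable_exp_0_1:
  fixes U :: "nat \<Rightarrow> 'a \<Rightarrow> real"
  assumes indep: "indep_vars (\<lambda>_. borel) U UNIV"
  defines "E \<equiv> {w \<in> space M. \<not> summable (\<lambda>n. exp (\<Sum>i<n. U i w))}"
  shows "E \<in> events" "prob E = 0 \<or> prob E = 1"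
proof -
  have U [measurable]: "U i \<in> borel_measurable M" for i
    using indep by (simp add: indep_vars_def2)
  \<comment> \<open>Dropping the first \<open>m\<close> terms of the inner sum rescales the series by a positive constant.\<close>
  have tail: "E = {w \<in> space M. \<not> Cauchy (\<lambda>n. \<Sum>k<n. exp (\<Sum>i=m..<k + m. U i w))}" for m
  proof -
    have "summable (\<lambda>n. exp (\<Sum>i<n. U i w)) \<longleftrightarrow>
        Cauchy (\<lambda>n. \<Sum>k<n. exp (\<Sum>i=m..<k + m. U i w))" for w
    proof -
      have "exp (\<Sum>i<k + m. U i w) = exp (\<Sum>i<m. U i w) * exp (\<Sum>i=m..<k + m. U i w)" for k
        by (simp add: exp_add[symmetric] lessThan_atLeast0 sum.atLeastLessThan_concat)
      then have "summable (\<lambda>n. exp (\<Sum>i<n. U i w)) \<longleftrightarrow>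
          summable (\<lambda>k. exp (\<Sum>i<m. U i w) * exp (\<Sum>i=m..<k + m. U i w))"
        using summable_iff_shift[of "\<lambda>n. exp (\<Sum>i<n. U i w)" m] by simp
      also have "\<dots> \<longleftrightarrow> summable (\<lambda>k. exp (\<Sum>i=m..<k + m. U i w))"
        by (subst summable_cmult_iff) simp
      \<comment> \<open>The Cauchy criterion can be tested with countably many tolerances and
        indices, so it gives an event measurable in the \<open>U i\<close> with
        \<open>m \<le> i\<close>.\<close>
      finally show ?thesis by (simp add: summable_iff_convergent Cauchy_convergent_iff)
    qed
    then show ?thesis by (simp add: E_def)
  qed
  let ?A = "\<lambda>i. {U i -` B \<inter> space M | B. B \<in> sets borel}"
  have "E \<in> tail_events ?A"
    unfolding tail_events_def
  proof (rule INT_I)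
    fix m :: nat
    define N where "N = sigma (space M) (\<Union> (?A ` {m..}))"
    have sets_N: "sets N = sigma_sets (space M) (\<Union> (?A ` {m..}))"
      unfolding N_def by (rule sets_measure_of) auto
    have space_N: "space N = space M" unfolding N_def by (rule space_measure_of) auto
    have [measurable]: "U i \<in> borel_measurable N" if "m \<le> i" for i
      using that by (intro measurableI) (auto simp: space_N sets_N intro!: sigma_sets.Basic)
    have [measurable]: "(\<lambda>w. \<Sum>i=m..<k. U i w) \<in> borel_measurable N" for k
      by (rule borel_measurable_sum) simp
    have "{w \<in> space N. \<not> Cauchy (\<lambda>n. \<Sum>k<n. exp (\<Sum>i=m..<k + m. U i w))} \<in> sets N"
      by measurable
    then show "E \<in> sigma_sets (space M) (\<Union> (?A ` {m..}))"
      unfolding tail[of m] by (simp add: space_N sets_N)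
  qed
  moreover have "sigma_algebra (space M) (?A i)" for i
    using sets.sigma_algebra_axioms[of "vimage_algebra (space M) (U i) borel"]
    by (simp add: sets_vimage_algebra2)
  ultimately show "prob E = 0 \<or> prob E = 1"
    using indep by (intro kolmogorov_0_1_law[of ?A]) (auto simp: indep_vars_def2)
  show "E \<in> events" unfolding tail[of 0] by measurable
qed

text \<open>The tail identity makes the distribution functions of \<open>Z\<close> and
  \<open>- Z\<close> equal, so the expectation equals its own negative.\<close>

lemma (in prob_space) expectation_symmetric_eq_0:
  fixes Z :: "'a \<Rightarrow> real"
  assumes [measurable]: "Z \<in> borel_measurable M"
    and sym: "\<And>x. 0 \<le> x \<Longrightarrow> prob {w \<in> space M. Z w \<le> - x} = prob {w \<in> space M. x \<le> Z w}"
  shows "expectation Z = 0"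
proof -
  \<comment> \<open>The distribution function at a positive point is reached by complementation,
    which turns weak inequalities into strict ones. These come from weak ones at the levels
    \<open>x + e n\<close> decreasing to \<open>x\<close>.\<close>
  have strict: "prob {w \<in> space M. Z w < - x} = prob {w \<in> space M. x < Z w}" if "0 \<le> x" for x
  proof (rule LIMSEQ_unique)
    define e where "e n = inverse (real (Suc n))" for n
    have e: "0 < e n" "e (Suc n) \<le> e n" for n by (simp_all add: e_def)
    have small: "\<exists>n. e n \<le> y" if "0 < y" for y
      using reals_Archimedean[OF that] by (auto simp: e_def intro: less_imp_le)
    have U1: "(\<Union>n. {w \<in> space M. x + e n \<le> Z w}) = {w \<in> space M. x < Z w}"
    proof (safe; clarsimp)
      fix w assume "x < Z w"
      then obtain n where "e n \<le> Z w - x" using small[of "Z w - x"] by auto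
      then show "\<exists>n. x + e n \<le> Z w" by (intro exI[of _ n]) simp
    qed (use e(1) in \<open>meson less_add_same_cancel1 less_le_trans\<close>)
    have U2: "(\<Union>n. {w \<in> space M. Z w \<le> - (x + e n)}) = {w \<in> space M. Z w < - x}"
    proof (safe; clarsimp)
      fix w assume "Z w < - x"
      then obtain n where "e n \<le> - x - Z w" using small[of "- x - Z w"] by auto
      then show "\<exists>n. Z w \<le> - x - e n" by (intro exI[of _ n]) simp
    next
      fix w n assume "Z w \<le> - x - e n"
      then show "Z w < - x" using e(1)[of n] by linarith
    qed
    have "(\<lambda>n. prob {w \<in> space M. Z w \<le> - (x + e n)}) \<longlonglongrightarrow> prob (\<Union>n. {w \<in> space M. Z w \<le> - (x + e n)})"
    proof (rule finite_Lim_measure_incseq)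
      show "incseq (\<lambda>n. {w \<in> space M. Z w \<le> - (x + e n)})"
      proof (rule incseq_SucI, safe)
        fix n w assume "Z w \<le> - (x + e n)"
        then show "Z w \<le> - (x + e (Suc n))" using e(2)[of n] by linarith
      qed
    qed (rule image_subsetI, measurable)
    then show "(\<lambda>n. prob {w \<in> space M. Z w \<le> - (x + e n)}) \<longlonglongrightarrow> prob {w \<in> space M. Z w < - x}"
      unfolding U2 .
    have "(\<lambda>n. prob {w \<in> space M. x + e n \<le> Z w}) \<longlonglongrightarrow> prob (\<Union>n. {w \<in> space M. x + e n \<le> Z w})"
    proof (rule finite_Lim_measure_incseq)
      show "incseq (\<lambda>n. {w \<in> space M. x + e n \<le> Z w})"
      proof (rule incseq_SucI, safe)
        fix n w assume "x + e n \<le> Z w"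
        then show "x + e (Suc n) \<le> Z w" using e(2)[of n] by linarith
      qed
    qed (rule image_subsetI, measurable)
    moreover have "prob {w \<in> space M. Z w \<le> - (x + e n)} = prob {w \<in> space M. x + e n \<le> Z w}" for n
      using that e(1)[of n] by (intro sym) simp
    ultimately show "(\<lambda>n. prob {w \<in> space M. Z w \<le> - (x + e n)}) \<longlonglongrightarrow> prob {w \<in> space M. x < Z w}"
      unfolding U1 by simp
  qed
  have "prob {w \<in> space M. Z w \<le> y} = prob {w \<in> space M. - Z w \<le> y}" for y
  proof (cases "y \<le> 0")
    case True
    then show ?thesis using sym[of "- y"] by (simp add: minus_le_iff)
  next
    case False
    have "prob {w \<in> space M. Z w \<le> y} = 1 - prob {w \<in> space M. y < Z w}"
      by (subst prob_neg[symmetric]) (auto simp: not_less)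
    also have "\<dots> = 1 - prob {w \<in> space M. Z w < - y}"
      using strict[of y] False by simp
    also have "\<dots> = prob {w \<in> space M. - Z w \<le> y}"
      by (subst prob_neg[symmetric]) (auto simp: not_less minus_le_iff)
    finally show ?thesis .
  qed
  then have "distr M borel Z = distr M borel (\<lambda>w. - Z w)"
    by (intro cdf_unique real_distribution_distr ext) (auto simp: cdf_def measure_distr vimage_def Int_def conj_commute)
  then have "(\<integral>x. x \<partial>distr M borel Z) = (\<integral>x. x \<partial>distr M borel (\<lambda>w. - Z w))" by simp
  then show ?thesis by (simp add: integral_distr)
qed

text \<open>The law has a density, so 1 is not an atom; the density is positive, so the interval
  from 1 to 2 carries mass. Continuity at 1 lets weak convergence be evaluated there.\<close>

lemma std_normal_tail_pos: "cdf std_normal_distribution 1 < 1" "isCont (cdf std_normal_distribution) 1"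
proof -
  interpret N: real_distribution std_normal_distribution by (rule real_dist_normal_dist)
  have "{1} \<in> null_sets std_normal_distribution"
  proof (subst null_sets_density_iff)
    show "{1} \<in> sets lborel \<and> (AE x in lborel. x \<in> {1} \<longrightarrow> ennreal (std_normal_density x) = 0)"
      by (intro conjI eventually_mono[OF AE_lborel_singleton[of "1 :: real"]]) auto
  qed simp
  then show "isCont (cdf std_normal_distribution) 1"
    unfolding N.isCont_cdf by (simp add: null_sets_def measure_def)
  have "{1<..} \<notin> null_sets std_normal_distribution"
  proof
    assume "{1<..} \<in> null_sets std_normal_distribution"
    then have "AE x in lborel. x \<in> {1<..} \<longrightarrow> ennreal (std_normal_density x) = 0"
      by (subst (asm) null_sets_density_iff) auto
    then have "AE x in lborel. x \<notin> {1<..2::real}"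
      using normal_density_pos[of 1 0] by (auto elim!: eventually_mono simp: ennreal_eq_0_iff not_le[symmetric])
    then have "{1<..2::real} \<in> null_sets lborel" by (simp add: AE_iff_null_sets)
    then show False by (simp add: null_sets_def)
  qed
  then have "0 < measure std_normal_distribution {1<..}"
    using N.emeasure_eq_measure[of "{1<..}"] by (auto simp: null_sets_def zero_less_measure_iff)
  also have "{1<..} = space std_normal_distribution - {..1::real}" by auto
  finally show "cdf std_normal_distribution 1 < 1"
    by (subst (asm) N.prob_compl) (auto simp: cdf_def)
qed

section \<open>The random environment\<close>

context mixed_environment
begin

lemma chi_measurable [measurable]: "chi n \<in> borel_measurable M"
  using chi_indep by (simp add: indep_vars_def2)

lemma \<xi>_measurable [measurable]: "\<xi> n \<in> borel_measurable M"
  using \<xi>_indep by (simp add: indep_vars_def2)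

lemma zeta_measurable [measurable]: "zeta \<xi> n \<in> borel_measurable M"
  unfolding zeta_def[abs_def] by measurable

lemma zeta_indep: "indep_vars (\<lambda>_. borel) (zeta \<xi>) UNIV"
  unfolding zeta_def[abs_def]
  by (rule indep_vars_compose2[OF \<xi>_indep, where Y = "\<lambda>_ x. ln (x / (1 - x))"]) measurable

lemma zeta_ident: "distr M borel (zeta \<xi> n) = distr M borel (zeta \<xi> 0)"
proof -
  have "distr M borel (zeta \<xi> k) = distr (distr M borel (\<xi> k)) borel (\<lambda>x. ln (x / (1 - x)))" for k
    unfolding zeta_def[abs_def] by (subst distr_distr) (auto simp: comp_def)
  from this[of n] this[of 0] show ?thesis by (simp only: \<xi>_ident[of n])
qed

lemma chi_\<xi>_indep_at: "indep_var borel (chi n) borel (\<xi> n)"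
  using indep_var_compose[OF chi_\<xi>_indep, of "\<lambda>f. f n" borel "\<lambda>f. f n" borel]
  by (simp add: comp_def)

lemma chi_zeta_indep: "indep_var borel (chi n) borel (zeta \<xi> n)"
  using indep_var_compose[OF chi_\<xi>_indep_at, of "\<lambda>x. x" borel "\<lambda>x. ln (x / (1 - x))" borel]
  by (simp add: comp_def zeta_def[abs_def])

section \<open>Log-odds of the environment and their independence\<close>

definition drift :: real where "drift = ln ((1 - \<delta>) / (1 + \<delta>))"

definition log_odds :: "nat \<Rightarrow> 'a \<Rightarrow> real" where
  "log_odds n w = (1 - chi n w) * zeta \<xi> n w + drift * chi n w"

lemma log_odds_measurable [measurable]: "log_odds n \<in> borel_measurable M"
  unfolding log_odds_def[abs_def] by measurable

lemma nondegenerate_walk_env: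
  assumes "w \<in> space M"
  shows "nondegenerate_walk (env \<delta> chi \<xi> w)"
proof -
  have "0 < env \<delta> chi \<xi> w n \<and> env \<delta> chi \<xi> w n < 1" for n
    using chi_values[OF assms, of n] \<xi>_values[OF assms, of n] \<delta>_bounds by (auto simp: env_def)
  then show ?thesis by unfold_locales auto
qed

lemma odds_prod_env:
  assumes "w \<in> space M"
  shows "odds_prod (env \<delta> chi \<xi> w) n = exp (\<Sum>k=1..n. log_odds k w)"
proof -
  have "env \<delta> chi \<xi> w k / (1 - env \<delta> chi \<xi> w k) = exp (log_odds k w)" for k
  proof -
    consider "chi k w = 0" | "chi k w = 1" using chi_values[OF assms, of k] by auto
    then show ?thesis
    proof cases
      case 1
      then show ?thesis using \<xi>_values[OF assms, of k] by (simp add: env_def log_odds_def zeta_def)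
    next
      case 2
      have "(1 - \<delta>) / 2 / (1 - (1 - \<delta>) / 2) = (1 - \<delta>) / (1 + \<delta>)"
        using \<delta>_bounds by (simp add: field_simps)
      then show ?thesis using 2 \<delta>_bounds by (simp add: env_def log_odds_def drift_def del: divide_divide_eq_left)
    qed
  qed
  then show ?thesis by (simp add: odds_prod_def exp_sum)
qed

text \<open>Independence between the two sequences and within each makes the pairs at different
  sites independent, first on rectangles and then on the generated sigma-algebras.
  \<open>log_odds n\<close> is a measurable function of the pair at \<open>n\<close>.\<close>

lemma log_odds_indep: "indep_vars (\<lambda>_. borel) log_odds UNIV"
proof -
  \<comment> \<open>A \<open>\<pi>\<close>-system generating the \<open>\<sigma>\<close>-algebra of the pair \<open>(chi n, \<xi> n)\<close>.\<close>
  define F where "F n = {chi n -` A \<inter> \<xi> n -` B \<inter> space M | A B. A \<in> sets borel \<and> B \<in> sets borel}" for n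
  have F_events: "F n \<subseteq> events" for n
  proof
    fix X assume "X \<in> F n"
    then obtain A B where X: "X = (chi n -` A \<inter> space M) \<inter> (\<xi> n -` B \<inter> space M)"
      and [measurable]: "A \<in> sets borel" "B \<in> sets borel" by (auto simp: F_def)
    show "X \<in> events" unfolding X by measurable
  qed
  have prob_pair: "prob (chi n -` A \<inter> \<xi> n -` B \<inter> space M) =
      prob (chi n -` A \<inter> space M) * prob (\<xi> n -` B \<inter> space M)"
    if "A \<in> sets borel" "B \<in> sets borel" for A B n
  proof -
    have "chi n -` A \<inter> \<xi> n -` B \<inter> space M = (\<lambda>w. (chi n w, \<xi> n w)) -` (A \<times> B) \<inter> space M" by auto
    then show ?thesis using indep_varD[OF chi_\<xi>_indep_at that] by simp
  qed
  have "indep_sets F UNIV"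
  proof (rule indep_setsI)
    show "F n \<subseteq> events" for n by (rule F_events)
    fix X and J :: "nat set"
    assume J: "J \<noteq> {}" "finite J" and "\<forall>j\<in>J. X j \<in> F j"
    then obtain A B where X: "\<And>j. j \<in> J \<Longrightarrow> X j = chi j -` A j \<inter> \<xi> j -` B j \<inter> space M"
      and [measurable]: "\<And>j. j \<in> J \<Longrightarrow> A j \<in> sets borel" "\<And>j. j \<in> J \<Longrightarrow> B j \<in> sets borel"
      unfolding F_def mem_Collect_eq by metis
    let ?P = "\<Pi>\<^sub>M n\<in>UNIV. borel :: real measure"
    have box: "{f. \<forall>j\<in>J. f j \<in> D j} \<in> sets ?P" if "\<And>j. j \<in> J \<Longrightarrow> D j \<in> sets borel" for D
    proof -
      have "{f. \<forall>j\<in>J. f j \<in> D j} = prod_emb UNIV (\<lambda>_. borel) J (\<Pi>\<^sub>E j\<in>J. D j)"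
        by (auto simp: prod_emb_def space_PiM PiE_iff)
      also have "\<dots> \<in> sets ?P" using J(2) that by (intro sets_PiM_I) auto
      finally show ?thesis .
    qed
    \<comment> \<open>The probability factors first between the two sequences, then over the sites
      within each; \<open>prob_pair\<close> regroups the factors by site.\<close>
    have "prob (\<Inter>j\<in>J. X j) = prob ((\<lambda>w. (\<lambda>n. chi n w, \<lambda>n. \<xi> n w)) -`
        ({f. \<forall>j\<in>J. f j \<in> A j} \<times> {f. \<forall>j\<in>J. f j \<in> B j}) \<inter> space M)"
      using J(1) X by (intro arg_cong[where f = prob]) auto
    also have "\<dots> = prob ((\<lambda>w n. chi n w) -` {f. \<forall>j\<in>J. f j \<in> A j} \<inter> space M) *
        prob ((\<lambda>w n. \<xi> n w) -` {f. \<forall>j\<in>J. f j \<in> B j} \<inter> space M)"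
      by (rule indep_varD[OF chi_\<xi>_indep]) (auto intro!: box)
    also have "(\<lambda>w n. chi n w) -` {f. \<forall>j\<in>J. f j \<in> A j} \<inter> space M = (\<Inter>j\<in>J. chi j -` A j \<inter> space M)"
      using J(1) by auto
    also have "(\<lambda>w n. \<xi> n w) -` {f. \<forall>j\<in>J. f j \<in> B j} \<inter> space M = (\<Inter>j\<in>J. \<xi> j -` B j \<inter> space M)"
      using J(1) by auto
    also have "prob (\<Inter>j\<in>J. chi j -` A j \<inter> space M) = (\<Prod>j\<in>J. prob (chi j -` A j \<inter> space M))"
      by (rule indep_varsD[OF chi_indep]) (use J in auto)
    also have "prob (\<Inter>j\<in>J. \<xi> j -` B j \<inter> space M) = (\<Prod>j\<in>J. prob (\<xi> j -` B j \<inter> space M))"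
      by (rule indep_varsD[OF \<xi>_indep]) (use J in auto)
    also have "(\<Prod>j\<in>J. prob (chi j -` A j \<inter> space M)) * (\<Prod>j\<in>J. prob (\<xi> j -` B j \<inter> space M)) =
        (\<Prod>j\<in>J. prob (X j))"
      unfolding prod.distrib[symmetric] by (rule prod.cong) (simp_all add: X prob_pair)
    finally show "prob (\<Inter>j\<in>J. X j) = (\<Prod>j\<in>J. prob (X j))" .
  qed
  moreover have "Int_stable (F n)" for n
  proof (rule Int_stableI)
    fix X Y assume "X \<in> F n" "Y \<in> F n"
    then obtain A B A' B' where "X = chi n -` A \<inter> \<xi> n -` B \<inter> space M" "Y = chi n -` A' \<inter> \<xi> n -` B' \<inter> space M"
      "A \<in> sets borel" "B \<in> sets borel" "A' \<in> sets borel" "B' \<in> sets borel"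
      unfolding F_def by blast
    then have "X \<inter> Y = chi n -` (A \<inter> A') \<inter> \<xi> n -` (B \<inter> B') \<inter> space M"
      "A \<inter> A' \<in> sets borel" "B \<inter> B' \<in> sets borel" by auto
    then show "X \<inter> Y \<in> F n" unfolding F_def by (intro CollectI exI conjI)
  qed
  ultimately have "indep_sets (\<lambda>n. sigma_sets (space M) (F n)) UNIV"
    by (rule indep_sets_sigma)
  moreover have "{log_odds n -` A \<inter> space M | A. A \<in> sets borel} \<subseteq> sigma_sets (space M) (F n)" for n
  proof -
    define N where "N = sigma (space M) (F n)"
    have F_Pow: "F n \<subseteq> Pow (space M)" by (auto simp: F_def)
    have sets_N: "sets N = sigma_sets (space M) (F n)" and space_N: "space N = space M"
      using F_Pow by (simp_all add: N_def)
    have [measurable]: "chi n \<in> borel_measurable N"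
    proof (rule measurableI)
      fix A :: "real set" assume "A \<in> sets borel"
      then have "chi n -` A \<inter> \<xi> n -` UNIV \<inter> space M \<in> F n"
        unfolding F_def by (intro CollectI exI[of _ A] exI[of _ UNIV]) simp
      then show "chi n -` A \<inter> space N \<in> sets N" by (auto simp: space_N sets_N)
    qed simp
    have [measurable]: "\<xi> n \<in> borel_measurable N"
    proof (rule measurableI)
      fix A :: "real set" assume "A \<in> sets borel"
      then have "chi n -` UNIV \<inter> \<xi> n -` A \<inter> space M \<in> F n"
        unfolding F_def by (intro CollectI exI[of _ UNIV] exI[of _ A]) simp
      then show "\<xi> n -` A \<inter> space N \<in> sets N" by (auto simp: space_N sets_N)
    qed simp
    have "log_odds n \<in> borel_measurable N"
      unfolding log_odds_def[abs_def] zeta_def by measurable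
    then show ?thesis
      using measurable_sets[of "log_odds n" N borel] by (auto simp: space_N sets_N)
  qed
  ultimately have "indep_sets (\<lambda>n. {log_odds n -` A \<inter> space M | A. A \<in> sets borel}) UNIV"
    by (rule indep_sets_mono_sets)
  then show ?thesis by (simp add: indep_vars_def2)
qed

lemma expectation_chi: "expectation (chi n) = \<phi> n" and integrable_chi: "integrable M (chi n)"
proof -
  have eq: "chi n w = indicator {w \<in> space M. chi n w = 1} w" if "w \<in> space M" for w
    using chi_values[OF that, of n] that by auto
  have E: "{w \<in> space M. chi n w = 1} \<in> events" by measurable
  show "expectation (chi n) = \<phi> n"
    using E by (subst Bochner_Integration.integral_cong[OF refl eq]) (simp_all add: chi_prob)
  show "integrable M (chi n)"
    using E by (subst Bochner_Integration.integrable_cong[OF refl eq])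
      (simp_all add: integrable_real_indicator less_top[symmetric])
qed

end

lemma power_div_fact_le_exp:
  fixes x :: real
  assumes "0 \<le> x"
  shows "x ^ k / fact k \<le> exp x"
proof -
  have "(\<Sum>n\<in>{k}. x ^ n /\<^sub>R fact n) \<le> exp x"
    using assms sums_unique[OF exp_converges[of x]] summable_exp_generic[of x]
    by (simp only:) (intro sum_le_suminf, auto)
  then show ?thesis by (simp add: field_simps)
qed

text \<open>The exponential exceeds any term \<open>x ^ k / fact k\<close> of its series; once
  \<open>\<gamma> * k \<ge> 2\<close>, the reciprocal is at most of order
  \<open>n powr (- 2)\<close>.\<close>

lemma summable_exp_neg_powr:
  fixes \<kappa> \<gamma> :: real
  assumes "0 < \<kappa>" "0 < \<gamma>"
  shows "summable (\<lambda>n. exp (- (\<kappa> * real n powr \<gamma>)))"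
proof -
  obtain k :: nat where k: "2 / \<gamma> \<le> real k" using real_arch_simple by blast
  have "summable (\<lambda>n. fact k / \<kappa> ^ k * real n powr (- 2))"
    by (intro summable_mult) (simp add: summable_real_powr_iff)
  then show ?thesis
  proof (rule summable_comparison_test_ev[rotated])
    show "\<forall>\<^sub>F n in sequentially. norm (exp (- (\<kappa> * real n powr \<gamma>))) \<le> fact k / \<kappa> ^ k * real n powr (- 2)"
    proof (rule eventually_sequentiallyI[of 1])
      fix n :: nat assume n: "1 \<le> n"
      let ?x = "\<kappa> * real n powr \<gamma>"
      have "real n powr 2 \<le> real n powr (\<gamma> * real k)"
        using n k assms by (intro powr_mono) (auto simp: field_simps)
      also have "\<dots> = (real n powr \<gamma>) ^ k" using n by (simp add: powr_power mult.commute)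
      finally have "\<kappa> ^ k * real n powr 2 / fact k \<le> ?x ^ k / fact k"
        using assms by (simp add: power_mult_distrib divide_right_mono mult_left_mono)
      also have "\<dots> \<le> exp ?x" using assms by (intro power_div_fact_le_exp) simp
      finally have "inverse (exp ?x) \<le> inverse (\<kappa> ^ k * real n powr 2 / fact k)"
        using n assms by (intro le_imp_inverse_le) auto
      then show "norm (exp (- ?x)) \<le> fact k / \<kappa> ^ k * real n powr (- 2)"
        by (simp add: exp_minus powr_minus field_simps)
    qed
  qed
qed

section \<open>Moments of the log-odds and growth of their mean\<close>

locale symmetric_environment = mixed_environment +
  fixes \<beta> :: real
  assumes zeta_symmetric: "\<And>x. 0 \<le> x \<Longrightarrow>
      prob {w \<in> space M. zeta \<xi> 0 w \<le> - x} = prob {w \<in> space M. x \<le> zeta \<xi> 0 w}"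
    and zeta_0_square: "integrable M (\<lambda>w. (zeta \<xi> 0 w)\<^sup>2)"
    and zeta_0_nondegenerate: "0 < expectation (\<lambda>w. (zeta \<xi> 0 w)\<^sup>2)"
    and \<beta>_pos: "0 < \<beta>" and \<beta>_less: "\<beta> < 1"
    and \<phi>_powr: "\<And>n. 1 \<le> n \<Longrightarrow> \<phi> n = real n powr (- \<beta>)"
begin

definition \<sigma> :: real where "\<sigma> = sqrt (expectation (\<lambda>w. (zeta \<xi> 0 w)\<^sup>2))"

lemma \<sigma>_pos: "0 < \<sigma>" using zeta_0_nondegenerate by (simp add: \<sigma>_def)

lemma zeta_transfer:
  assumes [measurable]: "f \<in> borel_measurable (borel :: real measure)"
  shows "expectation (\<lambda>w. f (zeta \<xi> n w) :: real) = expectation (\<lambda>w. f (zeta \<xi> 0 w))"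
    and "integrable M (\<lambda>w. f (zeta \<xi> n w)) \<longleftrightarrow> integrable M (\<lambda>w. f (zeta \<xi> 0 w))"
proof -
  show "expectation (\<lambda>w. f (zeta \<xi> n w)) = expectation (\<lambda>w. f (zeta \<xi> 0 w))"
    using integral_distr[of "zeta \<xi> n" M borel f] integral_distr[of "zeta \<xi> 0" M borel f] zeta_ident[of n] by simp
  show "integrable M (\<lambda>w. f (zeta \<xi> n w)) \<longleftrightarrow> integrable M (\<lambda>w. f (zeta \<xi> 0 w))"
    using integrable_distr_eq[of "zeta \<xi> n" M borel f] integrable_distr_eq[of "zeta \<xi> 0" M borel f] zeta_ident[of n] by simp
qed

lemma zeta_square: "integrable M (\<lambda>w. (zeta \<xi> n w)\<^sup>2)" "expectation (\<lambda>w. (zeta \<xi> n w)\<^sup>2) = \<sigma>\<^sup>2"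
  using zeta_transfer[of "\<lambda>x. x\<^sup>2" n] zeta_0_square zeta_0_nondegenerate by (simp_all add: \<sigma>_def)

lemma integrable_zeta: "integrable M (zeta \<xi> n)"
  by (rule square_integrable_imp_integrable[OF zeta_measurable zeta_square(1)])

lemma expectation_zeta: "expectation (zeta \<xi> n) = 0"
  using zeta_transfer(1)[of "\<lambda>x. x" n] expectation_symmetric_eq_0[OF zeta_measurable zeta_symmetric] by simp

lemma expectation_chi_mult:
  assumes [measurable]: "f \<in> borel_measurable borel" and "integrable M (\<lambda>w. f (zeta \<xi> n w) :: real)"
  shows "expectation (\<lambda>w. chi n w * f (zeta \<xi> n w)) = \<phi> n * expectation (\<lambda>w. f (zeta \<xi> n w))"
    and "integrable M (\<lambda>w. chi n w * f (zeta \<xi> n w))"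
proof -
  have "indep_var borel (chi n) borel (\<lambda>w. f (zeta \<xi> n w))"
    using indep_var_compose[OF chi_zeta_indep, of "\<lambda>x. x" borel f borel] by (simp add: comp_def)
  from indep_var_lebesgue_integral[OF this integrable_chi assms(2)] indep_var_integrable[OF this integrable_chi assms(2)]
  show "expectation (\<lambda>w. chi n w * f (zeta \<xi> n w)) = \<phi> n * expectation (\<lambda>w. f (zeta \<xi> n w))"
    "integrable M (\<lambda>w. chi n w * f (zeta \<xi> n w))" by (simp_all add: expectation_chi)
qed

text \<open>\<open>zeta\<close> has mean zero and is independent of \<open>chi\<close> at the same
  site, so only the drift sites contribute to the mean.\<close>

lemma expectation_log_odds: "expectation (log_odds n) = drift * \<phi> n" and integrable_log_odds: "integrable M (log_odds n)"
proof -
  have eq: "log_odds n = (\<lambda>w. zeta \<xi> n w - chi n w * zeta \<xi> n w + drift * chi n w)"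
    by (auto simp: log_odds_def algebra_simps)
  note * = expectation_chi_mult[of "\<lambda>x. x" n, OF _ integrable_zeta]
  show "expectation (log_odds n) = drift * \<phi> n"
    unfolding eq using * integrable_zeta[of n] integrable_chi[of n] by (simp add: expectation_zeta expectation_chi)
  show "integrable M (log_odds n)"
    unfolding eq using * integrable_zeta[of n] integrable_chi[of n] by simp
qed

text \<open>Independent centred variables are uncorrelated. The constant comes from a pointwise
  bound: where \<open>chi n = 0\<close>, the square of a difference is at most twice the sum of the
  squares; where \<open>chi n = 1\<close>, only \<open>drift * (1 - \<phi> n)\<close> is
  left.\<close>

lemma orthogonal_log_odds:
  "orthogonal_sequence M (\<lambda>n w. log_odds n w - drift * \<phi> n) (2 * \<sigma>\<^sup>2 + 2 * drift\<^sup>2)"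
proof -
  let ?X = "\<lambda>n w. log_odds n w - drift * \<phi> n" and ?B = "\<lambda>n w. 2 * (zeta \<xi> n w)\<^sup>2 + 2 * drift\<^sup>2"
  have bound: "(?X n w)\<^sup>2 \<le> ?B n w" if w: "w \<in> space M" for n w
  proof -
    consider "chi n w = 0" | "chi n w = 1" using chi_values[OF w, of n] by auto
    then show ?thesis
    proof cases
      case 1
      have "(drift * \<phi> n)\<^sup>2 \<le> drift\<^sup>2 * 1"
        unfolding power_mult_distrib using \<phi>_bounds[of n] by (intro mult_left_mono power_le_one) auto
      moreover have "(zeta \<xi> n w - drift * \<phi> n)\<^sup>2 \<le> 2 * (zeta \<xi> n w)\<^sup>2 + 2 * (drift * \<phi> n)\<^sup>2"
        using zero_le_power2[of "zeta \<xi> n w + drift * \<phi> n"] by (simp add: power2_sum power2_diff)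
      ultimately show ?thesis using 1 by (simp add: log_odds_def)
    next
      case 2
      have "?X n w = drift * (1 - \<phi> n)" using 2 by (simp add: log_odds_def algebra_simps)
      then have "(?X n w)\<^sup>2 \<le> drift\<^sup>2 * 1"
        unfolding power_mult_distrib using \<phi>_bounds[of n] by (simp add: power_mult_distrib mult_left_le power_le_one)
      also have "\<dots> \<le> ?B n w" by simp
      finally show ?thesis .
    qed
  qed
  have B: "integrable M (?B n)" "expectation (?B n) = 2 * \<sigma>\<^sup>2 + 2 * drift\<^sup>2" for n
    using zeta_square[of n] by (simp_all add: prob_space)
  have sq: "integrable M (\<lambda>w. (?X n w)\<^sup>2)" for n
    by (rule Bochner_Integration.integrable_bound[OF B(1)]) (auto intro!: AE_I2 order_trans[OF bound])
  have indep: "indep_vars (\<lambda>_. borel) ?X UNIV"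
    by (rule indep_vars_compose2[OF log_odds_indep, where Y = "\<lambda>n x. x - drift * \<phi> n"]) simp
  have int: "integrable M (?X n)" and mean: "expectation (?X n) = 0" for n
    using integrable_log_odds[of n] by (simp_all add: expectation_log_odds prob_space)
  show ?thesis
  proof
    show "?X i \<in> borel_measurable M" for i by measurable
    show "integrable M (\<lambda>w. (?X i w)\<^sup>2)" for i by (rule sq)
    show "expectation (\<lambda>w. (?X i w)\<^sup>2) \<le> 2 * \<sigma>\<^sup>2 + 2 * drift\<^sup>2" for i
      unfolding B(2)[of i, symmetric] by (rule integral_mono[OF sq B(1) bound])
    show "expectation (\<lambda>w. ?X i w * ?X j w) = 0" if "i \<noteq> j" for i j
    proof -
      have "expectation (\<lambda>w. \<Prod>k\<in>{i, j}. ?X k w) = (\<Prod>k\<in>{i, j}. expectation (?X k))"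
        by (rule indep_vars_lebesgue_integral) (auto intro!: int indep_vars_subset[OF indep])
      then show ?thesis using that by (simp add: mean)
    qed
  qed
qed

text \<open>Every summand is at least the last one. The crude constant 1 is enough, since only sign
  and order of growth enter.\<close>

lemma sum_\<phi>_ge:
  assumes "1 \<le> n"
  shows "real n powr (1 - \<beta>) \<le> (\<Sum>k=1..n. \<phi> k)"
proof -
  have "real n powr (1 - \<beta>) = (\<Sum>k=1..n. real n powr (- \<beta>))"
    using assms powr_add[of "real n" 1 "- \<beta>"] by simp
  also have "\<dots> \<le> (\<Sum>k=1..n. \<phi> k)"
  proof (rule sum_mono)
    fix k assume "k \<in> {1..n}"
    then show "real n powr (- \<beta>) \<le> \<phi> k" using \<beta>_pos by (simp add: \<phi>_powr powr_mono2')
  qed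
  finally show ?thesis .
qed

text \<open>Integral comparison through the mean value theorem, with the step from 0 to 1 checked
  separately. The leading 1 absorbs the arbitrary value \<open>\<phi> 0\<close>.\<close>

lemma sum_\<phi>_le: "(\<Sum>i<n. \<phi> i) \<le> 1 + real n powr (1 - \<beta>) / (1 - \<beta>)"
proof -
  have step: "\<phi> (Suc n) \<le> (real (Suc n) powr (1 - \<beta>) - real n powr (1 - \<beta>)) / (1 - \<beta>)" for n
  proof (cases "n = 0")
    case True
    then show ?thesis using \<beta>_pos \<beta>_less by (simp add: \<phi>_powr field_simps)
  next
    case False
    have "\<exists>z>real n. z < real (Suc n) \<and> real (Suc n) powr (1 - \<beta>) - real n powr (1 - \<beta>) =
        (real (Suc n) - real n) * ((1 - \<beta>) * z powr (1 - \<beta> - 1))"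
      using False by (intro MVT2) (auto intro!: DERIV_powr[THEN DERIV_cong] derivative_eq_intros)
    then obtain z where z: "real n < z" "z < real (Suc n)"
      "real (Suc n) powr (1 - \<beta>) - real n powr (1 - \<beta>) = (1 - \<beta>) * z powr (- \<beta>)" by auto
    have "\<phi> (Suc n) \<le> z powr (- \<beta>)"
      using z False \<beta>_pos by (simp add: \<phi>_powr del: of_nat_Suc) (intro powr_mono2', auto)
    then show ?thesis unfolding z(3) using \<beta>_less by simp
  qed
  \<comment> \<open>The induction includes the index \<open>n\<close> in the sum; the claim then
    follows by dropping the nonnegative \<open>\<phi> n\<close>.\<close>
  have "(\<Sum>i<Suc n. \<phi> i) \<le> 1 + real n powr (1 - \<beta>) / (1 - \<beta>)"
  proof (induction n)
    case 0
    have "(\<Sum>i<Suc 0. \<phi> i) = \<phi> 0" by simp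
    moreover have "0 \<le> real 0 powr (1 - \<beta>) / (1 - \<beta>)" using \<beta>_less by simp
    ultimately show ?case using \<phi>_bounds[of 0] by linarith
  next
    case (Suc n)
    have "(\<Sum>i<Suc (Suc n). \<phi> i) = (\<Sum>i<Suc n. \<phi> i) + \<phi> (Suc n)" by (rule sum.lessThan_Suc)
    then show ?case using Suc.IH step[of n] unfolding diff_divide_distrib by linarith
  qed
  moreover have "(\<Sum>i<Suc n. \<phi> i) = (\<Sum>i<n. \<phi> i) + \<phi> n" by (rule sum.lessThan_Suc)
  ultimately show ?thesis using \<phi>_bounds[of n] by linarith
qed

section \<open>The regime \<beta> < 1/2\<close>

text \<open>Here the exponent \<open>1 - \<beta>\<close> exceeds 1/2, so the strong law makes the
  fluctuations negligible against the mean.\<close>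

lemma AE_log_odds_sum:
  assumes "\<beta> < 1 / 2" and "0 < \<epsilon>"
  shows "AE w in M. \<forall>\<^sub>F n in sequentially.
    \<bar>(\<Sum>k=1..n. log_odds k w) - drift * (\<Sum>k=1..n. \<phi> k)\<bar> \<le> \<epsilon> * real n powr (1 - \<beta>)"
proof -
  interpret X: orthogonal_sequence M "\<lambda>n w. log_odds n w - drift * \<phi> n" "2 * \<sigma>\<^sup>2 + 2 * drift\<^sup>2"
    by (rule orthogonal_log_odds)
  have "AE w in M. (\<lambda>n. (\<Sum>i=1..n. log_odds i w - drift * \<phi> i) / real n powr (1 - \<beta>)) \<longlonglongrightarrow> 0"
    by (rule X.strong_law) (use assms in simp)
  then show ?thesis
  proof (rule AE_mp, intro AE_I2 impI)
    fix w assume "(\<lambda>n. (\<Sum>i=1..n. log_odds i w - drift * \<phi> i) / real n powr (1 - \<beta>)) \<longlonglongrightarrow> 0"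
    then have "\<forall>\<^sub>F n in sequentially. \<bar>(\<Sum>i=1..n. log_odds i w - drift * \<phi> i) / real n powr (1 - \<beta>)\<bar> < \<epsilon>"
      using assms(2) by (auto simp: tendsto_iff dist_real_def)
    then show "\<forall>\<^sub>F n in sequentially.
        \<bar>(\<Sum>k=1..n. log_odds k w) - drift * (\<Sum>k=1..n. \<phi> k)\<bar> \<le> \<epsilon> * real n powr (1 - \<beta>)"
      using eventually_gt_at_top[of 0]
    proof eventually_elim
      case (elim n)
      then have "\<bar>\<Sum>i=1..n. log_odds i w - drift * \<phi> i\<bar> < \<epsilon> * real n powr (1 - \<beta>)"
        by (simp add: abs_divide field_simps)
      then show ?case by (simp add: sum_subtractf sum_distrib_left)
    qed
  qed
qed

text \<open>With tolerance \<open>drift\<close>, the fluctuation is at most the lower bound for the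
  mean. The log-odds sums are eventually nonnegative, so the terms of the series do not tend to
  0.\<close>

lemma AE_recurrent_if_negative_drift:
  assumes "\<beta> < 1 / 2" "\<delta> < 0"
  shows "AE w in M. recurrent_chain (walk_kernel (env \<delta> chi \<xi> w))"
proof -
  have d: "0 < drift" using assms \<delta>_bounds by (simp add: drift_def)
  show ?thesis
  proof (rule AE_mp[OF AE_log_odds_sum[OF assms(1) d]], intro AE_I2 impI)
    fix w assume w: "w \<in> space M" and
      ev: "\<forall>\<^sub>F n in sequentially. \<bar>(\<Sum>k=1..n. log_odds k w) - drift * (\<Sum>k=1..n. \<phi> k)\<bar> \<le> drift * real n powr (1 - \<beta>)"
    have "\<forall>\<^sub>F n in sequentially. 1 \<le> odds_prod (env \<delta> chi \<xi> w) n"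
      using ev eventually_gt_at_top[of 0]
    proof eventually_elim
      case (elim n)
      have "drift * real n powr (1 - \<beta>) \<le> drift * (\<Sum>k=1..n. \<phi> k)"
        using sum_\<phi>_ge[of n] elim d by (intro mult_left_mono) auto
      then have "0 \<le> (\<Sum>k=1..n. log_odds k w)" using elim by linarith
      then show ?case by (simp add: odds_prod_env[OF w])
    qed
    then have "\<not> odds_prod (env \<delta> chi \<xi> w) \<longlonglongrightarrow> 0"
      using tendsto_lowerbound[of "odds_prod (env \<delta> chi \<xi> w)" 0 sequentially 1] by auto
    then have "\<not> summable (odds_prod (env \<delta> chi \<xi> w))"
      using summable_LIMSEQ_zero by (rule contrapos_nn)
    then show "recurrent_chain (walk_kernel (env \<delta> chi \<xi> w))"
      by (rule nondegenerate_walk.recurrent_if_not_summable[OF nondegenerate_walk_env[OF w]])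
  qed
qed

lemma AE_transient_if_positive_drift:
  assumes "\<beta> < 1 / 2" "0 < \<delta>"
  shows "AE w in M. transient_chain (walk_kernel (env \<delta> chi \<xi> w))"
proof -
  have d: "drift < 0" using assms \<delta>_bounds by (simp add: drift_def)
  \<comment> \<open>Half of the decay guaranteed by the mean is given up to the fluctuations; the
    other half remains in the exponent.\<close>
  define \<kappa> where "\<kappa> = - drift / 2"
  have \<kappa>: "0 < \<kappa>" using d by (simp add: \<kappa>_def)
  show ?thesis
  proof (rule AE_mp[OF AE_log_odds_sum[OF assms(1) \<kappa>]], intro AE_I2 impI)
    fix w assume w: "w \<in> space M" and
      ev: "\<forall>\<^sub>F n in sequentially. \<bar>(\<Sum>k=1..n. log_odds k w) - drift * (\<Sum>k=1..n. \<phi> k)\<bar> \<le> \<kappa> * real n powr (1 - \<beta>)"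
    have "\<forall>\<^sub>F n in sequentially. norm (odds_prod (env \<delta> chi \<xi> w) n) \<le> exp (- (\<kappa> * real n powr (1 - \<beta>)))"
      using ev eventually_gt_at_top[of 0]
    proof eventually_elim
      case (elim n)
      have "drift * (\<Sum>k=1..n. \<phi> k) \<le> drift * real n powr (1 - \<beta>)"
        using sum_\<phi>_ge[of n] elim d by (intro mult_left_mono_neg) auto
      also have "\<dots> = - (\<kappa> * real n powr (1 - \<beta>)) - \<kappa> * real n powr (1 - \<beta>)"
        by (simp add: \<kappa>_def)
      finally have "(\<Sum>k=1..n. log_odds k w) \<le> - (\<kappa> * real n powr (1 - \<beta>))" using elim by linarith
      then show ?case by (simp add: odds_prod_env[OF w])
    qed
    then have "summable (odds_prod (env \<delta> chi \<xi> w))"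
      by (rule summable_comparison_test_ev) (rule summable_exp_neg_powr[OF \<kappa>], use \<beta>_less in simp)
    then show "transient_chain (walk_kernel (env \<delta> chi \<xi> w))"
      by (rule nondegenerate_walk.transient_if_summable[OF nondegenerate_walk_env[OF w]])
  qed
qed

section \<open>The regime \<beta> > 1/2\<close>

text \<open>By the central limit theorem the sum of the \<open>zeta\<close> exceeds one standard
  deviation \<open>s n\<close> with probability close to \<open>p\<close>. This margin absorbs the
  perturbation by the drift sites, which Markov's inequality keeps below \<open>s n\<close> with
  high probability.\<close>

lemma prob_log_odds_sum_nonneg:
  assumes "1 / 2 < \<beta>"
  obtains \<epsilon> where "0 < \<epsilon>"
    "\<forall>\<^sub>F n in sequentially. \<epsilon> \<le> prob {w \<in> space M. 0 \<le> (\<Sum>i<n. log_odds i w)}"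
proof -
  define s where "s n = sqrt (real n * \<sigma>\<^sup>2)" for n
  define Z where "Z n w = (\<Sum>i<n. zeta \<xi> i w) / s n" for n w
  \<comment> \<open>Bounds how much the drift sites can lower the sum of the \<open>zeta\<close>,
    whatever the sign of \<open>drift\<close>.\<close>
  define G where "G n w = (\<Sum>i<n. chi i w * (\<bar>zeta \<xi> i w\<bar> + \<bar>drift\<bar>))" for n w
  define L where "L = expectation (\<lambda>w. \<bar>zeta \<xi> 0 w\<bar>) + \<bar>drift\<bar>"
  have [measurable]: "Z n \<in> borel_measurable M" "G n \<in> borel_measurable M" for n
    unfolding Z_def[abs_def] G_def[abs_def] by measurable
  define p where "p = 1 - cdf std_normal_distribution 1"
  have p: "0 < p" using std_normal_tail_pos(1) by (simp add: p_def)

  have "weak_conv_m (\<lambda>n. distr M borel (Z n)) std_normal_distribution"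
    unfolding Z_def[abs_def] s_def
    by (rule central_limit_theorem_zero_mean[OF zeta_indep expectation_zeta \<sigma>_pos zeta_square(1) _ zeta_ident])
      (simp add: zeta_square expectation_zeta)
  then have "(\<lambda>n. cdf (distr M borel (Z n)) 1) \<longlonglongrightarrow> cdf std_normal_distribution 1"
    using std_normal_tail_pos(2) by (simp add: weak_conv_m_def weak_conv_def)
  then have "(\<lambda>n. 1 - cdf (distr M borel (Z n)) 1) \<longlonglongrightarrow> p"
    unfolding p_def by (intro tendsto_intros)
  moreover have "1 - cdf (distr M borel (Z n)) 1 = prob {w \<in> space M. 1 < Z n w}" for n
  proof -
    have "cdf (distr M borel (Z n)) 1 = prob {w \<in> space M. Z n w \<le> 1}"
      by (auto simp: cdf_def measure_distr vimage_def Int_def conj_commute)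
    moreover have "prob {w \<in> space M. \<not> Z n w \<le> 1} = 1 - prob {w \<in> space M. Z n w \<le> 1}"
      by (rule prob_neg) measurable
    ultimately show ?thesis by (simp add: not_le)
  qed
  \<comment> \<open>A quarter of \<open>p\<close> is lost here and another quarter to Markov's
    inequality, leaving \<open>p / 2\<close>.\<close>
  ultimately have Z: "\<forall>\<^sub>F n in sequentially. 3 / 4 * p < prob {w \<in> space M. 1 < Z n w}"
    using p by (intro order_tendstoD(1)) auto

  have abs_int: "integrable M (\<lambda>w. \<bar>zeta \<xi> i w\<bar> + \<bar>drift\<bar>)" for i
    using integrable_zeta[of i] by simp
  have G_i: "integrable M (\<lambda>w. chi i w * (\<bar>zeta \<xi> i w\<bar> + \<bar>drift\<bar>))"
    "expectation (\<lambda>w. chi i w * (\<bar>zeta \<xi> i w\<bar> + \<bar>drift\<bar>)) = \<phi> i * L" for i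
  proof -
    have "expectation (\<lambda>w. \<bar>zeta \<xi> i w\<bar> + \<bar>drift\<bar>) = L"
      using integrable_zeta[of i] zeta_transfer(1)[of abs i] by (simp add: L_def prob_space)
    then show "integrable M (\<lambda>w. chi i w * (\<bar>zeta \<xi> i w\<bar> + \<bar>drift\<bar>))"
      "expectation (\<lambda>w. chi i w * (\<bar>zeta \<xi> i w\<bar> + \<bar>drift\<bar>)) = \<phi> i * L"
      using expectation_chi_mult[of "\<lambda>x. \<bar>x\<bar> + \<bar>drift\<bar>" i, OF _ abs_int] by simp_all
  qed
  have G_int: "integrable M (G n)" and G_mean: "expectation (G n) = (\<Sum>i<n. \<phi> i) * L" for n
    unfolding G_def[abs_def] using G_i by (simp_all add: sum_distrib_right)
  have L: "0 \<le> L" by (simp add: L_def)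
  have G_nonneg: "0 \<le> G n w" if "w \<in> space M" for n w
  proof -
    have "0 \<le> chi i w" for i using chi_values[OF that, of i] by auto
    then show ?thesis unfolding G_def by (intro sum_nonneg mult_nonneg_nonneg) auto
  qed
  \<comment> \<open>Bound for the mean of \<open>G n\<close> divided by \<open>s n\<close>. Up to
    constants it is \<open>n powr (- 1 / 2)\<close> plus \<open>n powr (1 / 2 - \<beta>)\<close>,
    and the latter vanishes because \<beta> exceeds 1/2.\<close>
  define b where "b n = (1 + real n powr (1 - \<beta>) / (1 - \<beta>)) * L / s n" for n
  have "(\<lambda>n. L / \<sigma> * (real n powr (- (1 / 2)) + real n powr (- (\<beta> - 1 / 2)) / (1 - \<beta>))) \<longlonglongrightarrow> L / \<sigma> * (0 + 0 / (1 - \<beta>))"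
    using assms \<beta>_less by (intro tendsto_intros tendsto_neg_powr filterlim_real_sequentially) auto
  moreover have "\<forall>\<^sub>F n in sequentially.
      L / \<sigma> * (real n powr (- (1 / 2)) + real n powr (- (\<beta> - 1 / 2)) / (1 - \<beta>)) = b n"
    using eventually_gt_at_top[of 0]
  proof eventually_elim
    case (elim n)
    have "s n = real n powr (1 / 2) * \<sigma>" using \<sigma>_pos by (simp add: s_def real_sqrt_mult powr_half_sqrt)
    moreover have "real n powr (- (\<beta> - 1 / 2)) = real n powr (1 - \<beta>) / real n powr (1 / 2)"
      by (simp add: powr_diff[symmetric])
    moreover have "real n powr (- (1 / 2)) = 1 / real n powr (1 / 2)"
      by (simp add: powr_minus field_simps)
    ultimately show ?case
      unfolding b_def using \<sigma>_pos by (simp add: add_divide_distrib distrib_left distrib_right mult.commute)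
  qed
  ultimately have "b \<longlonglongrightarrow> 0" by (simp add: tendsto_cong)
  then have b: "\<forall>\<^sub>F n in sequentially. b n < p / 4"
    using p by (intro order_tendstoD(2)) auto

  have "\<forall>\<^sub>F n in sequentially. p / 2 \<le> prob {w \<in> space M. 0 \<le> (\<Sum>i<n. log_odds i w)}"
    using Z b eventually_gt_at_top[of 0]
  proof eventually_elim
    case (elim n)
    have s: "0 < s n" using elim \<sigma>_pos by (simp add: s_def)
    have "prob {w \<in> space M. s n \<le> G n w} \<le> expectation (G n) / s n"
      by (rule integral_Markov_inequality_measure[OF G_int, of "{}"]) (use G_nonneg s in auto)
    also have "\<dots> \<le> b n"
      unfolding G_mean b_def using L s sum_\<phi>_le by (intro divide_right_mono mult_right_mono) auto
    finally have G: "prob {w \<in> space M. s n \<le> G n w} \<le> p / 4" using elim by simp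
    have "{w \<in> space M. 1 < Z n w} \<subseteq>
        {w \<in> space M. 0 \<le> (\<Sum>i<n. log_odds i w)} \<union> {w \<in> space M. s n \<le> G n w}"
    proof
      fix w assume "w \<in> {w \<in> space M. 1 < Z n w}"
      then have w: "w \<in> space M" and "s n < (\<Sum>i<n. zeta \<xi> i w)"
        using s by (simp_all add: Z_def field_simps)
      moreover have "(\<Sum>i<n. zeta \<xi> i w) - G n w \<le> (\<Sum>i<n. log_odds i w)"
        unfolding G_def sum_subtractf[symmetric]
      proof (rule sum_mono)
        fix i
        have "0 \<le> chi i w" using chi_values[OF w, of i] by auto
        then have "chi i w * (zeta \<xi> i w - drift) \<le> chi i w * (\<bar>zeta \<xi> i w\<bar> + \<bar>drift\<bar>)"
          by (intro mult_left_mono) auto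
        then show "zeta \<xi> i w - chi i w * (\<bar>zeta \<xi> i w\<bar> + \<bar>drift\<bar>) \<le> log_odds i w"
          by (simp add: log_odds_def algebra_simps)
      qed
      ultimately show "w \<in> {w \<in> space M. 0 \<le> (\<Sum>i<n. log_odds i w)} \<union> {w \<in> space M. s n \<le> G n w}"
        by auto
    qed
    then have "prob {w \<in> space M. 1 < Z n w} \<le>
        prob ({w \<in> space M. 0 \<le> (\<Sum>i<n. log_odds i w)} \<union> {w \<in> space M. s n \<le> G n w})"
      by (rule finite_measure_mono) measurable
    also have "\<dots> \<le> prob {w \<in> space M. 0 \<le> (\<Sum>i<n. log_odds i w)} + prob {w \<in> space M. s n \<le> G n w}"
      by (rule measure_Un_le) measurable
    finally show ?case using G elim by linarith
  qed
  then show thesis using p by (intro that[of "p / 2"]) auto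
qed

text \<open>If \<open>S n \<ge> 0\<close> infinitely often, the series has infinitely many terms at
  least 1. That event has probability at least \<epsilon>, and the zero-one law raises the
  probability of divergence to 1.\<close>

lemma AE_recurrent_if_sparse_drift:
  assumes "1 / 2 < \<beta>"
  shows "AE w in M. recurrent_chain (walk_kernel (env \<delta> chi \<xi> w))"
proof -
  define S where "S n w = (\<Sum>i<n. log_odds i w)" for n w
  have [measurable]: "S n \<in> borel_measurable M" for n unfolding S_def[abs_def] by measurable
  define E where "E = {w \<in> space M. \<not> summable (\<lambda>n. exp (S n w))}"
  have E: "E \<in> events" "prob E = 0 \<or> prob E = 1"
    unfolding E_def S_def using not_summable_exp_0_1[OF log_odds_indep] by auto
  obtain \<epsilon> N where \<epsilon>: "0 < \<epsilon>" and N: "\<And>n. N \<le> n \<Longrightarrow> \<epsilon> \<le> prob {w \<in> space M. 0 \<le> S n w}"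
    using prob_log_odds_sum_nonneg[OF assms] unfolding S_def eventually_sequentially by metis
  \<comment> \<open>These events decrease in \<open>m\<close>, and their intersection says that
    \<open>S n \<ge> 0\<close> for infinitely many \<open>n\<close>.\<close>
  define B where "B m = (\<Union>n\<in>{m..}. {w \<in> space M. 0 \<le> S n w})" for m
  have B_events: "B m \<in> events" for m unfolding B_def by measurable
  have "(\<lambda>m. prob (B m)) \<longlonglongrightarrow> prob (\<Inter>m. B m)"
  proof (intro finite_Lim_measure_decseq decseq_SucI)
    show "B (Suc m) \<subseteq> B m" for m unfolding B_def by (rule UN_mono) auto
  qed (use B_events in auto)
  moreover have "\<epsilon> \<le> prob (B m)" for m
  proof -
    have "\<epsilon> \<le> prob {w \<in> space M. 0 \<le> S (max m N) w}" by (rule N) simp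
    also have "\<dots> \<le> prob (B m)"
    proof (rule finite_measure_mono[OF _ B_events])
      show "{w \<in> space M. 0 \<le> S (max m N) w} \<subseteq> B m" unfolding B_def by (rule UN_upper) simp
    qed
    finally show ?thesis .
  qed
  ultimately have "\<epsilon> \<le> prob (\<Inter>m. B m)" by (intro LIMSEQ_le_const) auto
  also have "\<dots> \<le> prob E"
  proof (rule finite_measure_mono)
    show "(\<Inter>m. B m) \<subseteq> E"
    proof
      fix w assume w: "w \<in> (\<Inter>m. B m)"
      have "\<not> summable (\<lambda>n. exp (S n w))"
      proof
        assume "summable (\<lambda>n. exp (S n w))"
        then have "(\<lambda>n. exp (S n w)) \<longlonglongrightarrow> 0" by (rule summable_LIMSEQ_zero)
        then have "\<forall>\<^sub>F n in sequentially. exp (S n w) < 1" by (rule order_tendstoD) simp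
        then obtain m where "\<And>n. m \<le> n \<Longrightarrow> S n w < 0" by (auto simp: eventually_sequentially)
        then have "w \<notin> B m" by (force simp: B_def)
        then show False using w by blast
      qed
      moreover have "w \<in> space M" using w by (auto simp: B_def)
      ultimately show "w \<in> E" by (simp add: E_def)
    qed
  qed (rule E)
  finally have "prob E = 1" using E(2) \<epsilon> by auto
  then have "AE w in M. w \<in> E" using prob_eq_1[OF E(1)] by simp
  then show ?thesis
  proof (rule AE_mp, intro AE_I2 impI)
    fix w assume w: "w \<in> space M" and "w \<in> E"
    \<comment> \<open>\<open>S\<close> includes site 0 while \<open>odds_prod\<close> starts at site
      1, so the two series differ by a shift and a positive constant factor.\<close>
    have "exp (S (n + 1) w) = exp (log_odds 0 w) * odds_prod (env \<delta> chi \<xi> w) n" for n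
    proof -
      have "S (n + 1) w = log_odds 0 w + (\<Sum>k=1..n. log_odds k w)"
      proof -
        have "{..<n + 1} = insert 0 {1..n}" by auto
        then show ?thesis unfolding S_def by simp
      qed
      then show ?thesis by (simp add: odds_prod_env[OF w] exp_add)
    qed
    moreover have "\<not> summable (\<lambda>n. exp (S (n + 1) w))"
      using \<open>w \<in> E\<close> summable_iff_shift[of "\<lambda>n. exp (S n w)" 1] by (simp add: E_def)
    ultimately have "\<not> summable (odds_prod (env \<delta> chi \<xi> w))"
      using summable_mult[of "odds_prod (env \<delta> chi \<xi> w)" "exp (log_odds 0 w)"] by auto
    then show "recurrent_chain (walk_kernel (env \<delta> chi \<xi> w))"
      by (rule nondegenerate_walk.recurrent_if_not_summable[OF nondegenerate_walk_env[OF w]])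
  qed
qed

end

theorem theorem2p2:
  fixes M :: "'a measure" and \<delta> \<beta> :: real and \<phi> :: "nat \<Rightarrow> real" and chi \<xi> :: "nat \<Rightarrow> 'a \<Rightarrow> real"
  assumes "mixed_environment M \<delta> \<phi> chi \<xi>"
    and "\<And>x. x \<ge> 0 \<Longrightarrow>
      measure M {w \<in> space M. zeta \<xi> 0 w \<le> - x} = measure M {w \<in> space M. zeta \<xi> 0 w \<ge> x}"
    and "integrable M (\<lambda>w. (zeta \<xi> 0 w)\<^sup>2)"
    and "0 < (\<integral>w. (zeta \<xi> 0 w)\<^sup>2 \<partial>M)"
    and "0 < \<beta>" and "\<beta> < 1"
    and "\<And>n. n \<ge> 1 \<Longrightarrow> \<phi> n = real n powr (- \<beta>)"
  shows "(\<beta> < 1 / 2 \<longrightarrow>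
           (\<delta> < 0 \<longrightarrow> (AE w in M. recurrent_chain (walk_kernel (env \<delta> chi \<xi> w)))) \<and>
           (\<delta> > 0 \<longrightarrow> (AE w in M. transient_chain (walk_kernel (env \<delta> chi \<xi> w))))) \<and>
         (\<beta> > 1 / 2 \<longrightarrow> (AE w in M. recurrent_chain (walk_kernel (env \<delta> chi \<xi> w))))"
proof -
  have "symmetric_environment M \<delta> \<phi> chi \<xi> \<beta>"
    using assms by (simp add: symmetric_environment_def symmetric_environment_axioms_def)
  then interpret symmetric_environment M \<delta> \<phi> chi \<xi> \<beta> .
  show ?thesis
    by (intro conjI impI AE_recurrent_if_negative_drift AE_transient_if_positive_drift
        AE_recurrent_if_sparse_drift)
qed

end
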